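(* Consider the optimal inertia allocation problem stated in the context, and suppose that the disturbance-damping ratio is uniform, i.e. there is a constant $\lambda>0$ with $v_i/d_i=\lambda$ for all $i\in\{1,\dots,n\}$. Then this problem can be equivalently restated as the convex problem $$\underset{m\in\mathbb{R}^n}{\text{minimize}}\ \sum_{i=1}^n\frac{s_i}{m_i}\quad\text{subject to}\quad \sum_{i=1}^n m_i\le m_{\mathrm{bdg}},\qquad m_i\in[\underline{m_i},\overline{m_i}],\ i\in\{1,\dots,n\},$$ that is, this problem is convex, and a vector $m$ is the $m$-component of an optimal solution $(m,P)$ of the optimal inertia allocation problem if and only if $m$ is an optimal solution of this problem.
   Context: Setting. Let $n\ge 1$. The power network has nodes $\{1,\dots,n\}$ and symmetric susceptances $b_{ij}=b_{ji}\ge 0$ ($i\ne j$); $L\in\mathbb{R}^{n\times n}$ is the corresponding weighted graph Laplacian, with off-diagonal entries $-b_{ij}$ and diagonal entries $\sum_{j\ne i}b_{ij}$. The network graph (edges $\{i,j\}$ with $b_{ij}>0$) is connected. The nodes have inertia coefficients $m_i>0$ and damping coefficients $d_i>0$, and $M=\operatorname{diag}\{m_i\}$, $D=\operatorname{diag}\{d_i\}$. Disturbance strengths are $v_i\ge 0$, and $V=\operatorname{diag}\{v_i\}$. Penalties (fixed, not depending on $m$): $S=\operatorname{diag}\{s_i\}$ with $s_i>0$ the penalty coefficient for the frequency deviation at node $i$, and $N$ is the Laplacian matrix of a connected weighted graph on $\{1,\dots,n\}$ with weights $a_{ij}=a_{ji}\ge 0$ (not necessarily the same graph as the power network). The linear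 system $\mathscr{G}=(A,B,C)$ has state $(\theta,\omega)\in\mathbb{R}^{2n}$, input $\eta$ and output $y$, with $$A=\begin{bmatrix}0&I\\ -M^{-1}L&-M^{-1}D\end{bmatrix},\quad B=\begin{bmatrix}0\\ M^{-1}V^{1/2}\end{bmatrix},\quad C=\begin{bmatrix}N^{1/2}&0\\ 0&S^{1/2}\end{bmatrix}.$$ Its squared $\mathscr{H}_2$ norm is $\|\mathscr{G}\|_2^2=\int_0^\infty \operatorname{Trace}\big(B^{\mathsf T}e^{A^{\mathsf T}t}C^{\mathsf T}Ce^{At}B\big)\,dt$. Let $z_0\in\mathbb{R}^{2n}$ be the vector whose first $n$ entries are $1$ and whose last $n$ entries are $0$. Optimal inertia allocation problem: given bounds $0<\underline{m_i}\le\overline{m_i}$ and a budget $m_{\mathrm{bdg}}$, minimize over $m\in\mathbb{R}^n$ and $P\in\mathbb{R}^{2n\times 2n}$ the objective $\|\mathscr{G}\|_2^2=\operatorname{Trace}(B^{\mathsf T}PB)$ subject to $\sum_{i}m_i\le m_{\mathrm{bdg}}$, $m_i\in[\underline{m_i},\overline{m_i}]$ for all $i$, $PA+A^{\mathsf T}P+C^{\mathsf T}C=0$ and $Pz_0=0$ (where $A,B$ depend on $m$). *)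

theory Defs
  imports "HOL-Analysis.Analysis"
begin

definition diag_mat :: "real^'n \<Rightarrow> real^'n^'n" where
  "diag_mat x = (\<chi> i j. if i = j then x $ i else 0)"

text \<open>The index type of a matrix acting on stacked vectors \<open>(\<theta>, \<omega>)\<close> is the sum type
  \<open>'n + 'n\<close>; \<open>Inl\<close> indexes the first and \<open>Inr\<close> the last \<open>n\<close> entries.\<close>

definition block_mat ::
  "real^'c^'a \<Rightarrow> real^'d^'a \<Rightarrow> real^'c^'b \<Rightarrow> real^'d^'b \<Rightarrow> real^('c + 'd)^('a + 'b)" where
  "block_mat W X Y Z = (\<chi> i j. case i of
      Inl a \<Rightarrow> (case j of Inl c \<Rightarrow> W $ a $ c | Inr d \<Rightarrow> X $ a $ d)
    | Inr b \<Rightarrow> (case j of Inl c \<Rightarrow> Y $ b $ c | Inr d \<Rightarrow> Z $ b $ d))"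

definition block_col :: "real^'c^'a \<Rightarrow> real^'c^'b \<Rightarrow> real^'c^('a + 'b)" where
  "block_col X Y = (\<chi> i j. case i of Inl a \<Rightarrow> X $ a $ j | Inr b \<Rightarrow> Y $ b $ j)"

definition pos_semidef :: "real^'n^'n \<Rightarrow> bool" where
  "pos_semidef X \<longleftrightarrow> transpose X = X \<and> (\<forall>x. 0 \<le> x \<bullet> (X *v x))"

text \<open>The principal square root; meaningful for positive semidefinite arguments only.\<close>

definition mat_sqrt :: "real^'n^'n \<Rightarrow> real^'n^'n" where
  "mat_sqrt X = (THE R. pos_semidef R \<and> R ** R = X)"

text \<open>The class-based \<open>exp\<close> and \<open>^\<close> are of no use here: \<open>*\<close> on \<open>real^'n^'n\<close> is the
  entrywise product.\<close>

definition mat_exp :: "real^'n^'n \<Rightarrow> real^'n^'n" where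
  "mat_exp X = (\<Sum>k. (1 / fact k) *\<^sub>R (((**) X ^^ k) (mat 1)))"

text \<open>A weighted graph is given by \<open>w i j\<close> for \<open>i \<noteq> j\<close>; the values \<open>w i i\<close> are irrelevant.\<close>

definition nonneg_sym_weights :: "('n \<Rightarrow> 'n \<Rightarrow> real) \<Rightarrow> bool" where
  "nonneg_sym_weights w \<longleftrightarrow> (\<forall>i j. i \<noteq> j \<longrightarrow> w i j = w j i \<and> 0 \<le> w i j)"

definition connected_weights :: "('n \<Rightarrow> 'n \<Rightarrow> real) \<Rightarrow> bool" where
  "connected_weights w \<longleftrightarrow> (\<forall>i j. (i, j) \<in> {(k, l). k \<noteq> l \<and> 0 < w k l}\<^sup>*)"

definition laplacian :: "('n \<Rightarrow> 'n \<Rightarrow> real) \<Rightarrow> real^'n^'n" where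
  "laplacian w = (\<chi> i j. if i = j then (\<Sum>k\<in>UNIV - {i}. w i k) else - w i j)"

definition sys_A :: "real^'n^'n \<Rightarrow> real^'n \<Rightarrow> real^'n \<Rightarrow> real^('n + 'n)^('n + 'n)" where
  "sys_A L d m = block_mat 0 (mat 1)
    (- (matrix_inv (diag_mat m) ** L)) (- (matrix_inv (diag_mat m) ** diag_mat d))"

definition sys_B :: "real^'n \<Rightarrow> real^'n \<Rightarrow> real^'n^('n + 'n)" where
  "sys_B v m = block_col 0 (matrix_inv (diag_mat m) ** mat_sqrt (diag_mat v))"

definition sys_C :: "real^'n^'n \<Rightarrow> real^'n \<Rightarrow> real^('n + 'n)^('n + 'n)" where
  "sys_C N s = block_mat (mat_sqrt N) 0 0 (mat_sqrt (diag_mat s))"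

definition h2_integrand ::
  "real^'x^'x \<Rightarrow> real^'u^'x \<Rightarrow> real^'x^'y \<Rightarrow> real \<Rightarrow> real" where
  "h2_integrand A B C t = trace (transpose B ** mat_exp (t *\<^sub>R transpose A)
     ** transpose C ** C ** mat_exp (t *\<^sub>R A) ** B)"

text \<open>\<open>integral\<close> is a junk value for a non-integrable function, so this has to be used together
  with integrability of the integrand.\<close>

definition h2_norm_sq :: "real^'x^'x \<Rightarrow> real^'u^'x \<Rightarrow> real^'x^'y \<Rightarrow> real" where
  "h2_norm_sq A B C = integral {0..} (h2_integrand A B C)"

definition z0 :: "real^('n::finite + 'n)" where
  "z0 = (\<chi> i. case i of Inl _ \<Rightarrow> 1 | Inr _ \<Rightarrow> 0)"

definition inertia_set :: "real^'n \<Rightarrow> real^'n \<Rightarrow> real \<Rightarrow> (real^'n) set" where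
  "inertia_set mlo mhi mbdg =
    {m. (\<Sum>i\<in>UNIV. m $ i) \<le> mbdg \<and> (\<forall>i. m $ i \<in> {mlo $ i..mhi $ i})}"

definition alloc_feasible ::
  "real^'n^'n \<Rightarrow> real^'n^'n \<Rightarrow> real^'n \<Rightarrow> real^'n \<Rightarrow> real^'n \<Rightarrow> real^'n \<Rightarrow> real
    \<Rightarrow> (real^'n) \<times> (real^('n + 'n)^('n + 'n)) \<Rightarrow> bool" where
  "alloc_feasible L N d s mlo mhi mbdg = (\<lambda>(m, P).
     m \<in> inertia_set mlo mhi mbdg \<and>
     P ** sys_A L d m + transpose (sys_A L d m) ** P + transpose (sys_C N s) ** sys_C N s = 0 \<and>
     P *v z0 = 0)"

definition alloc_objective ::
  "real^'n \<Rightarrow> (real^'n) \<times> (real^('n + 'n)^('n + 'n)) \<Rightarrow> real" where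
  "alloc_objective v = (\<lambda>(m, P). trace (transpose (sys_B v m) ** P ** sys_B v m))"

definition reduced_objective :: "real^'n \<Rightarrow> real^'n \<Rightarrow> real" where
  "reduced_objective s m = (\<Sum>i\<in>UNIV. s $ i / m $ i)"

end

theory Submission
  imports Defs
begin

text \<open>Let \<open>P = [P11, P12; P21, P22]\<close> solve the Lyapunov equation. With \<open>v = \<lambda> d\<close> the objective is
  \<open>\<lambda> \<Sum>i. d i / (m i)\<^sup>2 * P22 i i\<close>, and the diagonal of the \<open>\<omega>\<omega>\<close>-block of the equation turns this
  into \<open>\<lambda>/2 (\<Sum>i. s i / m i + tr (M\<^sup>-\<^sup>1 (P12 + P21)))\<close>. The \<open>\<theta>\<theta>\<close>-block reads
  \<open>N = P12 M\<^sup>-\<^sup>1 L + L M\<^sup>-\<^sup>1 P21\<close>; multiplying it by an inverse \<open>G\<close> of \<open>L\<close> modulo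
  constants and taking traces identifies the second summand as \<open>tr (G N)\<close>, which does not depend on \<open>m\<close>.

  That a solution \<open>P\<close> exists for each \<open>m\<close> and that the objective is the squared \<open>H\<^sub>2\<close> norm both rest on
  \<open>e\<^sup>A\<^sup>t x\<close> converging to a multiple of \<open>z0\<close>, which is shown with an explicit strict Lyapunov function.\<close>

subsection \<open>Matrix algebra\<close>

lemma transpose_add: "transpose (X + Y) = transpose X + transpose (Y :: real^'m^'n)"
  by (vector transpose_def)

lemma transpose_uminus: "transpose (- X) = - transpose (X :: real^'m^'n)"
  by (vector transpose_def)

lemma transpose_zero: "transpose (0 :: real^'m^'n) = 0"
  by (vector transpose_def)

lemma bounded_linear_transpose: "bounded_linear (transpose :: real^'m^'n \<Rightarrow> _)"
  by (intro linear_conv_bounded_linear[THEN iffD1] linearI) (simp_all add: transpose_add transpose_scalar)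

lemma bounded_bilinear_matrix_mul:
  "bounded_bilinear ((**) :: real^'m^'n \<Rightarrow> real^'k^'m \<Rightarrow> real^'k^'n)"
proof -
  have "bilinear ((**) :: real^'m^'n \<Rightarrow> real^'k^'m \<Rightarrow> real^'k^'n)"
    unfolding bilinear_def
    by (auto intro!: linearI simp: vec_eq_iff matrix_matrix_mult_def sum_distrib_left
        sum.distrib distrib_left distrib_right ac_simps)
  then show ?thesis
    by (simp add: bilinear_conv_bounded_bilinear)
qed

interpretation matrix_mul: bounded_bilinear "(**) :: real^'m^'n \<Rightarrow> real^'k^'m \<Rightarrow> real^'k^'n"
  by (rule bounded_bilinear_matrix_mul)

lemma bounded_bilinear_matrix_vector_mul:
  "bounded_bilinear ((*v) :: real^'m^'n \<Rightarrow> real^'m \<Rightarrow> real^'n)"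
proof -
  have "bilinear ((*v) :: real^'m^'n \<Rightarrow> real^'m \<Rightarrow> real^'n)"
    unfolding bilinear_def
    by (auto intro!: linearI simp: matrix_vector_right_distrib matrix_vector_mult_add_rdistrib
        scaleR_matrix_vector_assoc matrix_vector_mult_scaleR)
  then show ?thesis
    by (simp add: bilinear_conv_bounded_bilinear)
qed

interpretation matrix_vec: bounded_bilinear "(*v) :: real^'m^'n \<Rightarrow> real^'m \<Rightarrow> real^'n"
  by (rule bounded_bilinear_matrix_vector_mul)

lemma inner_transpose: "x \<bullet> (transpose X *v y) = (X *v x) \<bullet> (y :: real^'n)" for X :: "real^'m^'n"
  by (metis dot_lmul_matrix inner_commute transpose_matrix_vector)

lemma inner_symmetric:
  "transpose X = X \<Longrightarrow> x \<bullet> (X *v y) = (X *v x) \<bullet> (y :: real^'n)" for X :: "real^'n^'n"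
  by (metis inner_transpose)

text \<open>Each diagonal entry is the quadratic form of \<open>X\<close> at a column of
  \<open>B\<close>, so statements about traces reduce to statements about single initial
  vectors.\<close>

lemma trace_congruence:
  "trace (transpose B ** X ** B) = (\<Sum>k\<in>UNIV. (B *v axis k 1) \<bullet> (X *v (B *v axis k 1)))"
  for B :: "real^'u^'x" and X :: "real^'x^'x"
proof -
  have "(transpose B ** X ** B) $ k $ k = (B *v axis k 1) \<bullet> (X *v (B *v axis k 1))" for k
  proof -
    have "(transpose B ** X ** B) $ k $ k = axis k 1 \<bullet> ((transpose B ** X ** B) *v axis k 1)"
      by (simp add: matrix_vector_mult_basis column_def inner_axis_axis inner_axis')
    also have "\<dots> = axis k 1 \<bullet> (transpose B *v (X *v (B *v axis k 1)))"
      by (simp add: matrix_vector_mul_assoc matrix_mul_assoc del: transpose_matrix_vector)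
    finally show ?thesis
      by (simp only: inner_transpose)
  qed
  then show ?thesis
    by (simp add: trace_def)
qed

subsection \<open>The matrix exponential\<close>

lemma mat_power_scaleR: "((**) (t *\<^sub>R X) ^^ k) (mat 1) = t ^ k *\<^sub>R ((**) X ^^ k) (mat 1)"
  for X :: "real^'n^'n"
  by (induction k) (simp_all add: matrix_mul.scaleR_left matrix_mul.scaleR_right)

lemma mat_power_commute: "((**) X ^^ k) (mat 1) ** X = X ** ((**) X ^^ k) (mat 1)"
  for X :: "real^'n^'n"
  by (induction k) (simp_all add: matrix_mul_assoc[symmetric])

lemma mat_power_transpose:
  "((**) (transpose X) ^^ k) (mat 1) = transpose (((**) X ^^ k) (mat 1))" for X :: "real^'n^'n"
  by (induction k) (simp_all add: matrix_transpose_mul mat_power_commute[symmetric])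

lemma summable_mat_exp: "summable (\<lambda>k. (1 / fact k) *\<^sub>R (((**) X ^^ k) (mat 1)))"
  for X :: "real^'n^'n"
proof -
  \<comment> \<open>Submultiplicativity up to a constant suffices: the series is dominated by a
    multiple of the exponential series of \<open>norm X * K\<close>.\<close>
  obtain K where K: "0 \<le> K" "\<And>(X::real^'n^'n) (Y::real^'n^'n). norm (X ** Y) \<le> norm X * norm Y * K"
    using matrix_mul.nonneg_bounded by blast
  define p where "p = (\<lambda>k. ((**) X ^^ k) (mat 1))"
  have "norm (p k) \<le> norm (mat 1 :: real^'n^'n) * (norm X * K) ^ k" for k
  proof (induction k)
    case 0
    then show ?case by (simp add: p_def)
  next
    case (Suc k)
    have "norm (p (Suc k)) \<le> norm X * norm (p k) * K"
      using K(2)[of X "p k"] by (simp add: p_def)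
    also have "\<dots> \<le> norm X * (norm (mat 1 :: real^'n^'n) * (norm X * K) ^ k) * K"
      using Suc K by (intro mult_right_mono mult_left_mono) auto
    finally show ?case by (simp add: ac_simps)
  qed
  then have "norm ((1 / fact k) *\<^sub>R p k)
      \<le> norm (mat 1 :: real^'n^'n) * (inverse (fact k) * (norm X * K) ^ k)" for k
    by (simp add: divide_simps)
  moreover have "summable (\<lambda>k. norm (mat 1 :: real^'n^'n) * (inverse (fact k) * (norm X * K) ^ k))"
    by (rule summable_mult[OF summable_exp])
  ultimately show ?thesis
    unfolding p_def by (rule summable_comparison_test'[rotated])
qed

text \<open>Entrywise the exponential is a scalar power series in \<open>t\<close>, which makes
  uniqueness of sums and termwise differentiation of real series available.\<close>

lemma mat_exp_nth:
  "(\<lambda>k. ((**) X ^^ k) (mat 1) $ i $ j / fact k * t ^ k) sums (mat_exp (t *\<^sub>R X) $ i $ j)"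
  for X :: "real^'n^'n"
proof -
  have "(\<lambda>k. (1 / fact k) *\<^sub>R (((**) (t *\<^sub>R X) ^^ k) (mat 1))) sums mat_exp (t *\<^sub>R X)"
    unfolding mat_exp_def by (rule summable_sums[OF summable_mat_exp])
  note S = sums_vec_nth[OF sums_vec_nth[OF this], of i j]
  have "((1 / fact k) *\<^sub>R (((**) (t *\<^sub>R X) ^^ k) (mat 1))) $ i $ j
      = ((**) X ^^ k) (mat 1) $ i $ j / fact k * t ^ k" for k
    unfolding mat_power_scaleR by simp
  with S show ?thesis by (simp only:)
qed

lemma mat_exp_zero: "mat_exp 0 = (mat 1 :: real^'n^'n)"
proof -
  have "mat_exp (0 *\<^sub>R 0) $ i $ j = (mat 1 :: real^'n^'n) $ i $ j" for i j
    using sums_unique2[OF mat_exp_nth powser_sums_zero[of "\<lambda>k. ((**) 0 ^^ k) (mat 1) $ i $ j / fact k"]]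
    by simp
  then show ?thesis by (simp add: vec_eq_iff)
qed

lemma mat_exp_transpose: "mat_exp (t *\<^sub>R transpose X) = transpose (mat_exp (t *\<^sub>R X))"
  for X :: "real^'n^'n"
proof -
  have "mat_exp (t *\<^sub>R transpose X) $ i $ j = transpose (mat_exp (t *\<^sub>R X)) $ i $ j" for i j
  proof (rule sums_unique2[OF mat_exp_nth])
    show "(\<lambda>k. ((**) (transpose X) ^^ k) (mat 1) $ i $ j / fact k * t ^ k)
        sums transpose (mat_exp (t *\<^sub>R X)) $ i $ j"
      using mat_exp_nth[of X j i t] unfolding mat_power_transpose by (simp add: transpose_def)
  qed
  then show ?thesis by (simp add: vec_eq_iff)
qed

lemma has_vector_derivative_mat_exp_mult:
  "((\<lambda>t. mat_exp (t *\<^sub>R X) *v x) has_vector_derivative X *v (mat_exp (t *\<^sub>R X) *v x)) (at t)"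
  for X :: "real^'n^'n"
proof -
  let ?c = "\<lambda>i j k. ((**) X ^^ k) (mat 1) $ i $ j / fact k"
  have eq: "mat_exp (t *\<^sub>R X) $ i $ j = (\<Sum>k. ?c i j k * t ^ k)" for i j t
    using mat_exp_nth by (rule sums_unique)
  have "((\<lambda>t. mat_exp (t *\<^sub>R X) $ i $ j) has_real_derivative (X ** mat_exp (t *\<^sub>R X)) $ i $ j) (at t)"
    for i j
  proof -
    \<comment> \<open>Differentiation shifts the index: the power k + 1 is \<open>X\<close> times
      the power k, and the factor k + 1 leaves \<open>fact k\<close> in the denominator.\<close>
    have diffs: "diffs (?c i j) k = (\<Sum>l\<in>UNIV. X $ i $ l * ?c l j k)" for k
      by (simp add: diffs_def matrix_matrix_mult_def sum_divide_distrib sum_distrib_left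
          divide_simps del: of_nat_Suc)
    have "(\<lambda>k. \<Sum>l\<in>UNIV. X $ i $ l * (?c l j k * t ^ k))
        sums (\<Sum>l\<in>UNIV. X $ i $ l * mat_exp (t *\<^sub>R X) $ l $ j)"
      by (intro sums_sum sums_mult mat_exp_nth)
    then have S: "(\<lambda>k. diffs (?c i j) k * t ^ k) sums (X ** mat_exp (t *\<^sub>R X)) $ i $ j"
      by (simp add: diffs sum_distrib_right matrix_matrix_mult_def mult.assoc)
    have "((\<lambda>t. \<Sum>k. ?c i j k * t ^ k) has_real_derivative (\<Sum>k. diffs (?c i j) k * t ^ k)) (at t)"
      by (rule termdiffs_strong_converges_everywhere) (rule sums_summable[OF mat_exp_nth])
    then show ?thesis
      unfolding eq sums_unique[OF S] .
  qed
  then have "((\<lambda>t. (mat_exp (t *\<^sub>R X) *v x) $ i) has_real_derivative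
      (X *v (mat_exp (t *\<^sub>R X) *v x)) $ i) (at t)" for i
    unfolding matrix_vector_mul_assoc
    by (auto simp: matrix_vector_mult_def intro!: derivative_eq_intros)
  then show ?thesis
    unfolding has_vector_derivative_def
    by (subst has_derivative_componentwise_within)
       (auto simp: Basis_vec_def inner_axis has_field_derivative_def mult.commute[of _ "_ $ _"])
qed

subsection \<open>The positive semidefinite square root\<close>

text \<open>The form at \<open>x + t *\<^sub>R y\<close> is a polynomial of degree at most two in
  \<open>t\<close> that is never negative, which constrains its coefficients.\<close>

lemma psd_cauchy_schwarz:
  assumes "pos_semidef X"
  shows "(x \<bullet> (X *v y))\<^sup>2 \<le> (x \<bullet> (X *v x)) * (y \<bullet> (X *v y))"
proof -
  have sym: "y \<bullet> (X *v x) = x \<bullet> (X *v y)"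
    using assms by (metis pos_semidef_def inner_symmetric inner_commute)
  have "0 \<le> (x + t *\<^sub>R y) \<bullet> (X *v (x + t *\<^sub>R y))" for t
    using assms by (simp add: pos_semidef_def)
  then have pos: "0 \<le> x \<bullet> (X *v x) + 2 * t * (x \<bullet> (X *v y)) + t\<^sup>2 * (y \<bullet> (X *v y))" for t
    by (simp add: matrix_vec.add_right matrix_vec.scaleR_right inner_simps sym power2_eq_square algebra_simps)
  define p q r where "p = x \<bullet> (X *v x)" and "q = x \<bullet> (X *v y)" and "r = y \<bullet> (X *v y)"
  have r0: "0 \<le> r" "0 \<le> p" using assms by (simp_all add: pos_semidef_def r_def p_def)
  show ?thesis
  proof (cases "r = 0")
    case True
    have "q = 0"
    proof (rule ccontr)
      assume "q \<noteq> 0"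
      \<comment> \<open>For \<open>r = 0\<close> the polynomial is affine in \<open>t\<close>; this
        value of \<open>t\<close> would make it -1.\<close>
      then have "p + 2 * (-(p + 1) / (2 * q)) * q = -1" by (simp add: field_simps)
      with pos[of "-(p + 1) / (2 * q)"] True show False
        by (simp add: p_def q_def r_def)
    qed
    then show ?thesis using True by (simp add: p_def q_def r_def)
  next
    case False
    \<comment> \<open>The minimum of the polynomial is attained at
      \<open>t = - q / r\<close>.\<close>
    have "0 \<le> p + 2 * (- q / r) * q + (- q / r)\<^sup>2 * r"
      using pos[of "- q / r"] by (simp add: p_def q_def r_def)
    also have "\<dots> = p - q\<^sup>2 / r"
      using False by (simp add: field_simps power2_eq_square)
    finally have "q\<^sup>2 \<le> p * r"
      using False r0 by (simp add: field_simps)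
    then show ?thesis by (simp add: p_def q_def r_def)
  qed
qed

text \<open>Cauchy-Schwarz for the pair \<open>X *v x\<close>, \<open>x\<close> bounds the fourth
  power of the norm of \<open>X *v x\<close> by a multiple of the vanishing form.\<close>

lemma psd_null:
  assumes "pos_semidef X" "x \<bullet> (X *v x) = 0"
  shows "X *v x = 0"
  using psd_cauchy_schwarz[OF assms(1), of "X *v x" x] assms(2) by simp

text \<open>Cauchy-Schwarz gives |Xx|^4 <= |Xx|^2 |x|^2, and a factor |Xx|^2 cancels.\<close>

lemma contraction_square_le:
  assumes "pos_semidef X" "\<And>x. x \<bullet> (X *v x) \<le> x \<bullet> x"
  shows "(X *v x) \<bullet> (X *v x) \<le> x \<bullet> x"
proof -
  let ?y = "X *v x"
  have "(?y \<bullet> ?y)\<^sup>2 \<le> (?y \<bullet> (X *v ?y)) * (x \<bullet> (X *v x))"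
    by (rule psd_cauchy_schwarz[OF assms(1)])
  also have "\<dots> \<le> (?y \<bullet> ?y) * (x \<bullet> x)"
    using assms by (intro mult_mono) (auto simp: pos_semidef_def)
  finally show ?thesis
    by (cases "?y = 0") (auto simp: power2_eq_square)
qed

text \<open>A fixed point of \<open>R \<mapsto> (I - X + R\<^sup>2) / 2\<close> satisfies \<open>(I - R)\<^sup>2 = X\<close>.\<close>

lemma psd_square_root_exists_contraction:
  fixes X :: "real^'n^'n"
  assumes "pos_semidef X" "\<And>x. x \<bullet> (X *v x) \<le> x \<bullet> x"
  shows "\<exists>R. pos_semidef R \<and> R ** R = X"
proof -
  \<comment> \<open>\<open>S\<close> consists of the symmetric matrices between 0 and the identity
    in the Loewner order; being compact and convex, it is a domain for Brouwer's theorem.\<close>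
  define S where "S = {R :: real^'n^'n. pos_semidef R \<and> (\<forall>x. x \<bullet> (R *v x) \<le> x \<bullet> x)}"
  define f where "f R = (1/2) *\<^sub>R (mat 1 - X + R ** R)" for R
  have S_eq: "S = {R. transpose R = R} \<inter> (\<Inter>x. {R. 0 \<le> x \<bullet> (R *v x)} \<inter> {R. x \<bullet> (R *v x) \<le> x \<bullet> x})"
    by (auto simp: S_def pos_semidef_def)
  have "closed S"
    unfolding S_eq
    by (intro closed_Int closed_INT ballI closed_Collect_eq closed_Collect_le
        bounded_linear.continuous_on[OF bounded_linear_transpose] continuous_intros
        matrix_vec.continuous_on)
  moreover have "norm R \<le> (\<Sum>i\<in>(UNIV::'n set). \<Sum>j\<in>(UNIV::'n set). 1)" if "R \<in> S" for R
  proof -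
    have nth: "\<bar>R $ i $ j\<bar> \<le> 1" for i j
    proof -
      have "norm (R *v axis j 1) \<le> 1"
        using contraction_square_le[of R "axis j 1"] that
        by (simp add: S_def norm_le_square inner_axis_axis dot_square_norm)
      then have "\<bar>(R *v axis j 1) $ i\<bar> \<le> 1"
        using component_le_norm_cart order_trans by blast
      then show ?thesis by (simp add: matrix_vector_mult_basis column_def)
    qed
    have "norm R \<le> (\<Sum>i\<in>UNIV. norm (R $ i))"
      by (simp add: norm_vec_def L2_set_le_sum)
    also have "\<dots> \<le> (\<Sum>i\<in>UNIV. \<Sum>j\<in>UNIV. \<bar>R $ i $ j\<bar>)"
      by (intro sum_mono norm_le_l1_cart)
    also have "\<dots> \<le> (\<Sum>i\<in>(UNIV::'n set). \<Sum>j\<in>(UNIV::'n set). 1)"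
      by (intro sum_mono nth)
    finally show ?thesis .
  qed
  then have "bounded S" unfolding bounded_iff by blast
  ultimately have "compact S" by (simp add: compact_eq_bounded_closed)
  moreover have "convex S"
  proof (rule convexI)
    fix Q R :: "real^'n^'n" and u w :: real
    assume QR: "Q \<in> S" "R \<in> S" and uw: "0 \<le> u" "0 \<le> w" "u + w = 1"
    have "x \<bullet> ((u *\<^sub>R Q + w *\<^sub>R R) *v x) = u * (x \<bullet> (Q *v x)) + w * (x \<bullet> (R *v x))" for x
      by (simp add: matrix_vec.add_left matrix_vec.scaleR_left inner_simps)
    moreover have "u * (x \<bullet> (Q *v x)) + w * (x \<bullet> (R *v x)) \<le> x \<bullet> x" for x
      using QR uw by (intro convex_bound_le) (auto simp: S_def)
    ultimately show "u *\<^sub>R Q + w *\<^sub>R R \<in> S"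
      using QR uw by (auto simp: S_def pos_semidef_def transpose_add transpose_scalar)
  qed
  moreover have "0 \<in> S" by (simp add: S_def pos_semidef_def transpose_zero)
  moreover have "continuous_on S f"
    unfolding f_def by (intro continuous_intros matrix_mul.continuous_on)
  moreover have "f \<in> S \<rightarrow> S"
  proof
    fix R assume R: "R \<in> S"
    have sym: "transpose R = R" using R by (simp add: S_def pos_semidef_def)
    \<comment> \<open>In this form the lower bound follows from the bound on \<open>X\<close>, and
      the upper bound from positivity of \<open>X\<close> together with |Rx| <= |x|.\<close>
    have form: "x \<bullet> (f R *v x) = (x \<bullet> x - x \<bullet> (X *v x) + (R *v x) \<bullet> (R *v x)) / 2" for x
      using inner_symmetric[OF sym, of x "R *v x"]
      by (simp add: f_def matrix_vec.add_left matrix_vec.diff_left matrix_vec.scaleR_left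
          inner_simps matrix_vector_mul_assoc)
    have "0 \<le> x \<bullet> (f R *v x)" for x
      using assms(2)[of x] by (simp add: form)
    moreover have "x \<bullet> (f R *v x) \<le> x \<bullet> x" for x
    proof -
      have "(R *v x) \<bullet> (R *v x) \<le> x \<bullet> x" "0 \<le> x \<bullet> (X *v x)"
        using contraction_square_le[of R x] R assms(1) by (auto simp: S_def pos_semidef_def)
      then show ?thesis by (simp add: form)
    qed
    moreover have "transpose (f R) = f R"
    proof -
      have "transpose (mat 1 + - X + R ** R) = mat 1 + - X + R ** R"
        using assms(1) sym unfolding transpose_add transpose_uminus
        by (simp add: pos_semidef_def matrix_transpose_mul)
      then show ?thesis by (simp add: f_def transpose_scalar)
    qed
    ultimately show "f R \<in> S" by (simp add: S_def pos_semidef_def)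
  qed
  ultimately obtain R where R: "R \<in> S" "f R = R"
    using brouwer[of S f] by blast
  have "2 *\<^sub>R R = mat 1 - X + R ** R"
    using arg_cong[OF R(2), of "(*\<^sub>R) 2"] by (simp add: f_def)
  then have "(mat 1 - R) ** (mat 1 - R) = X"
    by (simp add: matrix_mul.diff_left matrix_mul.diff_right scaleR_2 algebra_simps)
  moreover have "pos_semidef (mat 1 - R)"
    using R(1) transpose_add[of "mat 1" "- R"]
    by (auto simp: S_def pos_semidef_def matrix_vec.diff_left inner_simps transpose_uminus)
  ultimately show ?thesis by blast
qed

text \<open>Dividing by an operator bound \<open>c\<close> gives the contraction case; the root
  found there is scaled back by \<open>sqrt c\<close>.\<close>

lemma psd_square_root_exists:
  fixes X :: "real^'n^'n"
  assumes "pos_semidef X"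
  shows "\<exists>R. pos_semidef R \<and> R ** R = X"
proof -
  obtain c where c: "0 < c" "\<And>x. norm (X *v x) \<le> norm x * c"
    using bounded_linear.pos_bounded[OF matrix_vector_mul_bounded_linear, of X] by blast
  have "x \<bullet> (((1/c) *\<^sub>R X) *v x) \<le> x \<bullet> x" for x
  proof -
    have "x \<bullet> (X *v x) \<le> norm x * (norm x * c)"
      using norm_cauchy_schwarz[of x "X *v x"] mult_left_mono[OF c(2)[of x], of "norm x"] by simp
    then show ?thesis
      using c(1) by (simp add: matrix_vec.scaleR_left field_simps dot_square_norm power2_eq_square)
  qed
  moreover have "pos_semidef ((1/c) *\<^sub>R X)"
    using assms c(1) by (simp add: pos_semidef_def transpose_scalar matrix_vec.scaleR_left)
  ultimately obtain R where R: "pos_semidef R" "R ** R = (1/c) *\<^sub>R X"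
    using psd_square_root_exists_contraction by blast
  have "pos_semidef (sqrt c *\<^sub>R R)"
    using R(1) c(1) by (simp add: pos_semidef_def transpose_scalar matrix_vec.scaleR_left)
  moreover have "(sqrt c *\<^sub>R R) ** (sqrt c *\<^sub>R R) = X"
    using R(2) c(1) by (simp add: matrix_mul.scaleR_left matrix_mul.scaleR_right)
  ultimately show ?thesis by blast
qed

text \<open>Take a maximiser of the form on the unit sphere, with value \<mu>. Then \<mu> times the
  identity minus \<open>X\<close> is positive semidefinite and its form vanishes at the maximiser,
  so \<open>psd_null\<close> yields the eigenvector equation.\<close>

lemma symmetric_max_eigenvector:
  fixes X :: "real^'n^'n"
  assumes "transpose X = X"
  obtains x \<mu> where "x \<noteq> 0" "X *v x = \<mu> *\<^sub>R x" "\<And>y. y \<bullet> (X *v y) \<le> \<mu> * (y \<bullet> y)"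
proof -
  have "axis undefined 1 \<in> sphere (0::real^'n) 1" by simp
  then have "sphere (0::real^'n) 1 \<noteq> {}" by blast
  moreover have "continuous_on (sphere 0 1) (\<lambda>x. x \<bullet> (X *v x))"
    by (intro continuous_intros matrix_vec.continuous_on)
  ultimately obtain x where x: "norm x = 1" "\<And>y. norm y = 1 \<Longrightarrow> y \<bullet> (X *v y) \<le> x \<bullet> (X *v x)"
    using continuous_attains_sup[of "sphere (0::real^'n) 1" "\<lambda>x. x \<bullet> (X *v x)"] by auto
  define \<mu> where "\<mu> = x \<bullet> (X *v x)"
  have max: "y \<bullet> (X *v y) \<le> \<mu> * (y \<bullet> y)" for y
  proof (cases "y = 0")
    case False
    have "(y /\<^sub>R norm y) \<bullet> (X *v (y /\<^sub>R norm y)) \<le> \<mu>"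
      using x(2)[of "y /\<^sub>R norm y"] False by (simp add: \<mu>_def)
    then show ?thesis
      using False by (simp add: matrix_vec.scaleR_right field_simps dot_square_norm power2_eq_square)
  qed simp
  have "pos_semidef (\<mu> *\<^sub>R mat 1 - X)"
    using max assms transpose_add[of "\<mu> *\<^sub>R mat 1" "- X"]
    by (simp add: pos_semidef_def transpose_uminus transpose_scalar matrix_vec.diff_left
        matrix_vec.scaleR_left inner_simps)
  moreover have "x \<bullet> ((\<mu> *\<^sub>R mat 1 - X) *v x) = 0"
    using x(1) by (simp add: matrix_vec.diff_left matrix_vec.scaleR_left inner_simps \<mu>_def dot_square_norm)
  ultimately have "(\<mu> *\<^sub>R mat 1 - X) *v x = 0" by (rule psd_null)
  then have "X *v x = \<mu> *\<^sub>R x"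
    by (simp add: matrix_vec.diff_left matrix_vec.scaleR_left)
  moreover have "x \<noteq> 0" using x(1) by auto
  ultimately show ?thesis using that max by blast
qed

lemma symmetric_form_zero:
  fixes X :: "real^'n^'n"
  assumes "transpose X = X" "\<And>x. x \<bullet> (X *v x) = 0"
  shows "X = 0"
proof -
  have "pos_semidef X" using assms by (simp add: pos_semidef_def)
  then have "X *v x = 0" for x using psd_null assms(2) by blast
  then show ?thesis by (simp add: matrix_eq)
qed

text \<open>For square roots \<open>Q\<close>, \<open>R\<close> of the same matrix, \<open>Q (Q - R) = - (Q - R) R\<close>; evaluating this
  form at an eigenvector of \<open>Q - R\<close> with nonzero eigenvalue puts the eigenvector into both kernels.\<close>

lemma psd_square_root_le:
  fixes Q R :: "real^'n^'n"
  assumes "pos_semidef Q" "pos_semidef R" "Q ** Q = R ** R"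
  shows "x \<bullet> ((Q - R) *v x) \<le> 0"
proof -
  define X where "X = Q - R"
  have sym: "transpose X = X"
    using assms transpose_add[of Q "- R"] by (simp add: X_def transpose_uminus pos_semidef_def)
  obtain z \<mu> where z: "z \<noteq> 0" "X *v z = \<mu> *\<^sub>R z" "\<And>y. y \<bullet> (X *v y) \<le> \<mu> * (y \<bullet> y)"
    using symmetric_max_eigenvector[OF sym] by blast
  have "\<mu> = 0"
  proof (rule ccontr)
    assume "\<mu> \<noteq> 0"
    have "Q ** X = - (X ** R)"
      using assms(3) by (simp add: X_def matrix_mul.diff_left matrix_mul.diff_right)
    then have "z \<bullet> (Q *v (X *v z)) = - (z \<bullet> (X *v (R *v z)))"
      by (simp add: matrix_vector_mul_assoc matrix_vec.minus_left)
    also have "z \<bullet> (X *v (R *v z)) = \<mu> * (z \<bullet> (R *v z))"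
      by (simp add: inner_symmetric[OF sym, of z "R *v z"] z(2))
    finally have "\<mu> * (z \<bullet> (Q *v z)) = - (\<mu> * (z \<bullet> (R *v z)))"
      by (simp add: z(2) matrix_vec.scaleR_right)
    then have "\<mu> * (z \<bullet> (Q *v z) + z \<bullet> (R *v z)) = 0"
      by (simp add: distrib_left)
    then have "z \<bullet> (Q *v z) + z \<bullet> (R *v z) = 0" using \<open>\<mu> \<noteq> 0\<close> by simp
    moreover have "0 \<le> z \<bullet> (Q *v z)" "0 \<le> z \<bullet> (R *v z)"
      using assms by (auto simp: pos_semidef_def)
    ultimately have "z \<bullet> (Q *v z) = 0" "z \<bullet> (R *v z) = 0" by linarith+
    then have "Q *v z = 0" "R *v z = 0"
      using assms(1,2) by (blast intro: psd_null)+
    then have "X *v z = 0"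
      by (simp add: X_def matrix_vec.diff_left)
    then show False using z(1,2) \<open>\<mu> \<noteq> 0\<close> by simp
  qed
  then show ?thesis using z(3)[of x] by (simp add: X_def)
qed

lemma psd_square_root_unique:
  fixes Q R :: "real^'n^'n"
  assumes "pos_semidef Q" "pos_semidef R" "Q ** Q = R ** R"
  shows "Q = R"
proof -
  have "x \<bullet> ((Q - R) *v x) = 0" for x
    using psd_square_root_le[OF assms, of x] psd_square_root_le[OF assms(2,1) assms(3)[symmetric], of x]
    by (simp add: matrix_vec.diff_left inner_simps)
  moreover have "transpose (Q - R) = Q - R"
    using assms transpose_add[of Q "- R"] by (simp add: transpose_uminus pos_semidef_def)
  ultimately show ?thesis using symmetric_form_zero by force
qed

lemma mat_sqrt:
  assumes "pos_semidef X"
  shows "pos_semidef (mat_sqrt X)" "transpose (mat_sqrt X) = mat_sqrt X" "mat_sqrt X ** mat_sqrt X = X"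
proof -
  have "\<exists>!R. pos_semidef R \<and> R ** R = X"
    using psd_square_root_exists[OF assms] psd_square_root_unique by metis
  from theI'[OF this] show "pos_semidef (mat_sqrt X)" "mat_sqrt X ** mat_sqrt X = X"
    by (simp_all add: mat_sqrt_def)
  then show "transpose (mat_sqrt X) = mat_sqrt X"
    by (simp add: pos_semidef_def)
qed

subsection \<open>Trajectories and Lyapunov functions\<close>

text \<open>The link between the Lyapunov operator and trajectories: decay of the energy, the value
  of the integral and injectivity of the operator are all read off from this derivative.\<close>

lemma has_real_derivative_quadratic_form:
  fixes A X :: "real^'x^'x"
  assumes "(y has_vector_derivative A *v y t) (at t within S)"
  shows "((\<lambda>t. y t \<bullet> (X *v y t)) has_real_derivative
    y t \<bullet> ((X ** A + transpose A ** X) *v y t)) (at t within S)"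
proof -
  have "((\<lambda>t. X *v y t) has_vector_derivative X *v (A *v y t)) (at t within S)"
    by (rule bounded_linear.has_vector_derivative[OF matrix_vector_mul_bounded_linear assms])
  from bounded_bilinear.has_vector_derivative[OF bounded_bilinear_inner assms this]
  have "((\<lambda>t. y t \<bullet> (X *v y t)) has_vector_derivative
      y t \<bullet> (X *v (A *v y t)) + (A *v y t) \<bullet> (X *v y t)) (at t within S)" .
  moreover have "(A *v y t) \<bullet> (X *v y t) = y t \<bullet> ((transpose A ** X) *v y t)"
    by (simp add: inner_transpose[symmetric] matrix_vector_mul_assoc del: transpose_matrix_vector)
  ultimately show ?thesis
    by (simp add: has_real_derivative_iff_has_vector_derivative matrix_vector_mul_assoc
        matrix_vec.add_left inner_add_right)
qed

text \<open>The form attains a positive minimum on the compact unit sphere of \<open>V\<close>;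
  homogeneity extends the bound to all of \<open>V\<close>.\<close>

lemma coercive_on_subspace:
  fixes X :: "real^'x^'x"
  assumes "subspace V" "\<And>x. x \<in> V \<Longrightarrow> x \<noteq> 0 \<Longrightarrow> 0 < x \<bullet> (X *v x)"
  obtains c where "0 < c" "\<And>x. x \<in> V \<Longrightarrow> c * (x \<bullet> x) \<le> x \<bullet> (X *v x)"
proof (cases "V \<inter> sphere 0 1 = {}")
  \<comment> \<open>An empty unit sphere means that \<open>V\<close> contains only 0, and any
    constant will do.\<close>
  case True
  have zero: "x = 0" if "x \<in> V" for x
  proof (rule ccontr)
    assume "x \<noteq> 0"
    then have "x /\<^sub>R norm x \<in> V \<inter> sphere 0 1"
      using that assms(1) by (simp add: subspace_scale)
    with True show False by blast
  qed
  show ?thesis by (rule that[of 1]) (auto dest: zero)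
next
  case False
  moreover have "compact (V \<inter> sphere 0 1)"
    using assms(1) by (simp add: closed_Int_compact closed_subspace)
  moreover have "continuous_on (V \<inter> sphere 0 1) (\<lambda>x. x \<bullet> (X *v x))"
    by (intro continuous_intros matrix_vec.continuous_on)
  ultimately have "\<exists>z\<in>V \<inter> sphere 0 1. \<forall>x\<in>V \<inter> sphere 0 1. z \<bullet> (X *v z) \<le> x \<bullet> (X *v x)"
    by (intro continuous_attains_inf)
  then obtain z where z: "z \<in> V" "norm z = 1"
      "\<And>x. x \<in> V \<Longrightarrow> norm x = 1 \<Longrightarrow> z \<bullet> (X *v z) \<le> x \<bullet> (X *v x)"
    by (auto simp: Ball_def)
  have "z \<bullet> (X *v z) * (x \<bullet> x) \<le> x \<bullet> (X *v x)" if "x \<in> V" for x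
  proof (cases "x = 0")
    case False
    have "z \<bullet> (X *v z) \<le> (x /\<^sub>R norm x) \<bullet> (X *v (x /\<^sub>R norm x))"
      using z(3)[of "x /\<^sub>R norm x"] False that assms(1) by (simp add: subspace_scale)
    then show ?thesis
      using False by (simp add: matrix_vec.scaleR_right field_simps dot_square_norm power2_eq_square)
  qed simp
  moreover have "0 < z \<bullet> (X *v z)"
    using z(1,2) by (intro assms(2)) auto
  ultimately show ?thesis using that by blast
qed

text \<open>Along the trajectory the form of \<open>H\<close> decreases at a rate proportional to
  itself, hence decays exponentially. Positivity of \<open>K\<close> is required on \<open>V\<close>
  only, where the trajectory stays; this matters because the dissipation of the network vanishes at
  \<open>z0\<close>.\<close>

lemma strict_lyapunov_tendsto_zero:
  fixes A H K :: "real^'x^'x"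
  assumes y: "\<And>t. (y has_vector_derivative A *v y t) (at t)" "\<And>t. y t \<in> V"
    and V: "subspace V"
    and H: "\<And>x. x \<noteq> 0 \<Longrightarrow> 0 < x \<bullet> (H *v x)"
    and K: "\<And>x. x \<in> V \<Longrightarrow> x \<noteq> 0 \<Longrightarrow> 0 < x \<bullet> (K *v x)"
    and HA: "H ** A + transpose A ** H = - K"
  shows "(y \<longlongrightarrow> 0) at_top"
proof -
  obtain h where h: "0 < h" "\<And>x. h * (x \<bullet> x) \<le> x \<bullet> (H *v x)"
    using coercive_on_subspace[OF subspace_UNIV, of H] H by auto
  obtain k where k: "0 < k" "\<And>x. x \<in> V \<Longrightarrow> k * (x \<bullet> x) \<le> x \<bullet> (K *v x)"
    using coercive_on_subspace[OF V, of K] K by auto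
  obtain g where g: "0 < g" "\<And>x. norm (H *v x) \<le> norm x * g"
    using bounded_linear.pos_bounded[OF matrix_vector_mul_bounded_linear, of H] by blast
  have upper: "x \<bullet> (H *v x) \<le> g * (x \<bullet> x)" for x
    using norm_cauchy_schwarz[of x "H *v x"] mult_left_mono[OF g(2)[of x], of "norm x"]
    by (simp add: dot_square_norm power2_eq_square ac_simps)
  define W where "W t = y t \<bullet> (H *v y t)" for t
  \<comment> \<open>The rate \<open>k / g\<close> comes from y.Ky >= k |y|^2 >= (k/g) W; with this
    integrating factor, decay of \<open>W\<close> becomes monotonicity of \<open>E\<close>.\<close>
  define E where "E t = exp ((k / g) * t) * W t" for t
  have decay: "E t \<le> E 0" if "0 \<le> t" for t
  proof (rule DERIV_nonpos_imp_nonincreasing[OF that])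
    fix t
    have W': "(W has_real_derivative - (y t \<bullet> (K *v y t))) (at t)"
      using has_real_derivative_quadratic_form[OF y(1), of H t]
      unfolding W_def HA by (simp add: matrix_vec.minus_left)
    have "(E has_real_derivative exp ((k / g) * t) * ((k / g) * W t - y t \<bullet> (K *v y t))) (at t)"
      unfolding E_def using less_imp_neq[OF g(1)]
      by (auto intro!: derivative_eq_intros W' simp: algebra_simps)
    moreover have "(k / g) * W t \<le> y t \<bullet> (K *v y t)"
    proof -
      have "(k / g) * W t \<le> (k / g) * (g * (y t \<bullet> y t))"
        unfolding W_def using k(1) g(1) by (intro mult_left_mono upper) auto
      also have "\<dots> = k * (y t \<bullet> y t)" using less_imp_neq[OF g(1)] by simp
      finally show ?thesis using k(2)[OF y(2), of t] by linarith
    qed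
    ultimately show "\<exists>z. (E has_real_derivative z) (at t) \<and> z \<le> 0"
      by (auto simp: mult_le_0_iff)
  qed
  have bound: "(norm (y t))\<^sup>2 \<le> E 0 / h * exp (- (k / g * t))" if "0 \<le> t" for t
  proof -
    have "h * (norm (y t))\<^sup>2 \<le> W t"
      using h(2)[of "y t"] by (simp add: W_def dot_square_norm)
    also have "W t = E t * exp (- (k / g * t))"
      by (simp add: E_def exp_minus)
    also have "\<dots> \<le> E 0 * exp (- (k / g * t))"
      using decay[OF that] by simp
    finally show ?thesis using h(1) by (simp add: field_simps)
  qed
  have "((\<lambda>t. E 0 / h * exp (- (k / g * t))) \<longlongrightarrow> E 0 / h * 0) at_top"
  proof -
    have "filterlim (\<lambda>t. k / g * t) at_top at_top"
      using k(1) g(1)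
      by (intro filterlim_tendsto_pos_mult_at_top[OF tendsto_const _ filterlim_ident]) simp
    then have "filterlim (\<lambda>t. - (k / g * t)) at_bot at_top"
      by (simp add: filterlim_uminus_at_bot)
    then show ?thesis
      by (intro tendsto_mult tendsto_const filterlim_compose[OF exp_at_bot])
  qed
  then have lim: "((\<lambda>t. E 0 / h * exp (- (k / g * t))) \<longlongrightarrow> 0) at_top" by simp
  have "\<forall>\<^sub>F t in at_top. norm ((norm (y t))\<^sup>2) \<le> E 0 / h * exp (- (k / g * t))"
    using eventually_ge_at_top[of 0] by eventually_elim (use bound in simp)
  from Lim_null_comparison[OF this lim] have "((\<lambda>t. (norm (y t))\<^sup>2) \<longlongrightarrow> 0) at_top" .
  then have "((\<lambda>t. sqrt ((norm (y t))\<^sup>2)) \<longlongrightarrow> sqrt 0) at_top"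
    by (rule tendsto_real_sqrt)
  then show ?thesis by (simp add: tendsto_norm_zero_iff)
qed

section \<open>From the Lyapunov equation to the squared H2 norm\<close>

lemma lyapunov_form_tendsto_zero:
  fixes P :: "real^'x^'x"
  assumes "(y \<longlongrightarrow> \<alpha> *\<^sub>R z) at_top" "P *v z = 0"
  shows "((\<lambda>t. y t \<bullet> (P *v y t)) \<longlongrightarrow> 0) at_top"
proof -
  have "((\<lambda>t. y t \<bullet> (P *v y t)) \<longlongrightarrow> (\<alpha> *\<^sub>R z) \<bullet> (P *v (\<alpha> *\<^sub>R z))) at_top"
    by (intro tendsto_inner matrix_vec.tendsto tendsto_const assms)
  then show ?thesis using assms(2) by (simp add: matrix_vec.scaleR_right)
qed

text \<open>The negative of the form of \<open>P\<close> is an antiderivative of the integrand. It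
  tends to 0 because \<open>P\<close> annihilates the limit direction \<open>z\<close>, and
  nonnegativity of \<open>Q\<close> permits the passage from bounded intervals to the
  half-line.\<close>

lemma lyapunov_has_integral:
  fixes A P Q :: "real^'x^'x"
  assumes y: "\<And>t. (y has_vector_derivative A *v y t) (at t)" "(y \<longlongrightarrow> \<alpha> *\<^sub>R z) at_top"
    and P: "P ** A + transpose A ** P + Q = 0" "P *v z = 0"
    and Q: "\<And>x. 0 \<le> x \<bullet> (Q *v x)"
  shows "((\<lambda>t. y t \<bullet> (Q *v y t)) has_integral (y 0 \<bullet> (P *v y 0))) {0..}"
proof -
  define F where "F t = - (y t \<bullet> (P *v y t))" for t
  have "P ** A + transpose A ** P = - Q"
    using P(1) by (simp add: eq_neg_iff_add_eq_0)
  then have "(F has_real_derivative y t \<bullet> (Q *v y t)) (at t)" for t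
    using DERIV_minus[OF has_real_derivative_quadratic_form[OF y(1), of P t]]
    by (simp add: F_def[abs_def] matrix_vec.minus_left)
  then have F': "(F has_real_derivative y t \<bullet> (Q *v y t)) (at t within S)" for t S
    by (rule has_field_derivative_at_within)
  have int: "((\<lambda>t. y t \<bullet> (Q *v y t)) has_integral F b - F 0) {0..b}" if "0 \<le> b" for b
    using that F' by (intro fundamental_theorem_of_calculus)
      (auto simp: has_real_derivative_iff_has_vector_derivative[symmetric])
  show ?thesis
  proof (rule has_integral_to_inf)
    show "(\<lambda>t. y t \<bullet> (Q *v y t)) integrable_on {0..b}" for b
      using int[of b] by (cases "0 \<le> b") (auto simp: has_integral_integrable)
    have "((\<lambda>b. F b - F 0) \<longlongrightarrow> - 0 - F 0) at_top"
      unfolding F_def by (intro tendsto_intros lyapunov_form_tendsto_zero[OF y(2) P(2)])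
    then have "((\<lambda>b. F b - F 0) \<longlongrightarrow> y 0 \<bullet> (P *v y 0)) at_top"
      by (simp add: F_def)
    moreover have "\<forall>\<^sub>F b in at_top. F b - F 0 = integral {0..b} (\<lambda>t. y t \<bullet> (Q *v y t))"
      using eventually_ge_at_top[of 0] by eventually_elim (simp add: integral_unique[OF int])
    ultimately show "((\<lambda>b. integral {0..b} (\<lambda>t. y t \<bullet> (Q *v y t))) \<longlongrightarrow> y 0 \<bullet> (P *v y 0)) at_top"
      using tendsto_cong by force
  qed (use Q in auto)
qed

text \<open>As the exponential commutes with transposition, the integrand is the trace of a
  congruence and splits into the output energies of the trajectories started at the columns of
  \<open>B\<close>.\<close>

lemma h2_integrand_sum:
  "h2_integrand A B C t = (\<Sum>k\<in>UNIV. (mat_exp (t *\<^sub>R A) *v (B *v axis k 1)) \<bullet>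
    ((transpose C ** C) *v (mat_exp (t *\<^sub>R A) *v (B *v axis k 1))))"
proof -
  have "h2_integrand A B C t
      = trace (transpose (mat_exp (t *\<^sub>R A) ** B) ** (transpose C ** C) ** (mat_exp (t *\<^sub>R A) ** B))"
    by (simp add: h2_integrand_def mat_exp_transpose matrix_transpose_mul matrix_mul_assoc)
  then show ?thesis
    by (simp only: trace_congruence matrix_vector_mul_assoc)
qed

text \<open>Convergence to multiples of \<open>z\<close> replaces asymptotic stability, which fails
  for the network because \<open>A\<close> annihilates \<open>z0\<close>.\<close>

lemma h2_integrand_has_integral:
  fixes A P :: "real^'x^'x" and B :: "real^'u^'x" and C :: "real^'x^'y"
  assumes conv: "\<And>x. \<exists>\<alpha>. ((\<lambda>t. mat_exp (t *\<^sub>R A) *v x) \<longlongrightarrow> \<alpha> *\<^sub>R z) at_top"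
    and P: "P ** A + transpose A ** P + transpose C ** C = 0" "P *v z = 0"
  shows "(h2_integrand A B C has_integral trace (transpose B ** P ** B)) {0..}"
proof -
  have Q: "0 \<le> x \<bullet> ((transpose C ** C) *v x)" for x
    by (simp add: matrix_vector_mul_assoc[symmetric] inner_transpose del: transpose_matrix_vector)
  have "((\<lambda>t. (mat_exp (t *\<^sub>R A) *v x) \<bullet> ((transpose C ** C) *v (mat_exp (t *\<^sub>R A) *v x)))
      has_integral x \<bullet> (P *v x)) {0..}" for x
  proof -
    obtain \<alpha> where "((\<lambda>t. mat_exp (t *\<^sub>R A) *v x) \<longlongrightarrow> \<alpha> *\<^sub>R z) at_top"
      using conv by blast
    from lyapunov_has_integral[OF has_vector_derivative_mat_exp_mult this P Q] show ?thesis
      by (simp add: mat_exp_zero)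
  qed
  then show ?thesis
    unfolding h2_integrand_sum trace_congruence by (intro has_integral_sum) auto
qed

text \<open>The Lyapunov operator maps the symmetric matrices annihilating \<open>z\<close> into themselves;
  it is injective there because \<open>y \<bullet> X y\<close> is constant along trajectories if \<open>X\<close> is in its kernel.\<close>

lemma lyapunov_equation_solvable:
  fixes A Q :: "real^'x^'x"
  assumes conv: "\<And>x. \<exists>\<alpha>. ((\<lambda>t. mat_exp (t *\<^sub>R A) *v x) \<longlongrightarrow> \<alpha> *\<^sub>R z) at_top"
    and z: "A *v z = 0" and Q: "transpose Q = Q" "Q *v z = 0"
  shows "\<exists>P. P ** A + transpose A ** P + Q = 0 \<and> P *v z = 0"
proof -
  define U where "U = {X :: real^'x^'x. transpose X = X \<and> X *v z = 0}"
  define T where "T X = X ** A + transpose A ** X" for X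
  have subU: "subspace U"
    by (auto simp: subspace_def U_def transpose_add transpose_zero transpose_scalar
        matrix_vec.add_left matrix_vec.scaleR_left)
  have linT: "linear T"
    by (intro linearI) (simp_all add: T_def matrix_mul.add_left matrix_mul.add_right
        matrix_mul.scaleR_left matrix_mul.scaleR_right scaleR_add_right)
  have TU: "T ` U \<subseteq> U"
    using z by (auto simp: U_def T_def transpose_add matrix_transpose_mul add.commute matrix_vec.add_left
        matrix_vector_mul_assoc[symmetric] simp del: transpose_matrix_vector)
  have "X = 0" if X: "X \<in> U" "T X = 0" for X
  proof (rule symmetric_form_zero)
    show "transpose X = X" using X by (simp add: U_def)
    fix x
    define f where "f t = (mat_exp (t *\<^sub>R A) *v x) \<bullet> (X *v (mat_exp (t *\<^sub>R A) *v x))" for t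
    have "(f has_real_derivative 0) (at t)" for t
      using has_real_derivative_quadratic_form[where X = X,
          OF has_vector_derivative_mat_exp_mult[where X = A and x = x and t = t]] X(2)
      by (simp add: f_def[abs_def] T_def)
    then have const: "f t = f 0" for t
      using DERIV_isconst_all by blast
    obtain \<alpha> where "((\<lambda>t. mat_exp (t *\<^sub>R A) *v x) \<longlongrightarrow> \<alpha> *\<^sub>R z) at_top"
      using conv by blast
    then have "(f \<longlongrightarrow> 0) at_top"
      unfolding f_def using X(1) by (intro lyapunov_form_tendsto_zero) (auto simp: U_def)
    moreover have "f = (\<lambda>_. f 0)"
      using const by (rule ext)
    ultimately have "((\<lambda>_. f 0) \<longlongrightarrow> 0) (at_top :: real filter)"
      by (rule back_subst[where P = "\<lambda>g. (g \<longlongrightarrow> 0) at_top"])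
    then have "f 0 = 0"
      by (simp add: tendsto_const_iff)
    then show "x \<bullet> (X *v x) = 0"
      by (simp add: f_def mat_exp_zero)
  qed
  \<comment> \<open>An injective linear map of the finite-dimensional \<open>U\<close> into itself
    is onto, so \<open>- Q\<close> has a preimage in \<open>U\<close>.\<close>
  then have "inj_on T U"
    using linear_inj_on_iff_eq_0[OF linT subU] by blast
  then have "dim (T ` U) = dim U"
    using linT subU by (intro dim_image_eq) (simp_all add: span_eq_iff[THEN iffD2])
  then have "T ` U = U"
    using TU subU linT by (intro subspace_dim_equal linear_subspace_image) auto
  moreover have "- Q \<in> U"
    using Q by (simp add: U_def transpose_uminus matrix_vec.minus_left)
  ultimately obtain P where "P \<in> U" "T P = - Q" by (metis imageE)
  then have "P ** A + transpose A ** P + Q = 0" "P *v z = 0"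
    by (simp_all add: U_def T_def)
  then show ?thesis by blast
qed

subsection \<open>Block matrices\<close>

definition block_vec :: "real^'a \<Rightarrow> real^'b \<Rightarrow> real^('a + 'b)" where
  "block_vec p q = (\<chi> i. case i of Inl a \<Rightarrow> p $ a | Inr b \<Rightarrow> q $ b)"

lemma block_vec_nth [simp]:
  "block_vec p q $ Inl i = p $ i" "block_vec p q $ Inr j = q $ j"
  by (simp_all add: block_vec_def)

lemma block_mat_nth [simp]:
  "block_mat W X Y Z $ Inl i $ Inl k = W $ i $ k" "block_mat W X Y Z $ Inl i $ Inr l = X $ i $ l"
  "block_mat W X Y Z $ Inr j $ Inl k = Y $ j $ k" "block_mat W X Y Z $ Inr j $ Inr l = Z $ j $ l"
  by (simp_all add: block_mat_def)

lemma block_col_nth [simp]: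
  "block_col X Y $ Inl i = X $ i" "block_col X Y $ Inr j = Y $ j"
  by (simp_all add: block_col_def vec_eq_iff)

lemma all_sum_iff: "(\<forall>i. P i) \<longleftrightarrow> (\<forall>i. P (Inl i)) \<and> (\<forall>j. P (Inr j))"
  by (metis sum.exhaust)

lemma sum_UNIV_sum: "(\<Sum>i\<in>UNIV. f i) = (\<Sum>i\<in>UNIV. f (Inl i)) + (\<Sum>j\<in>UNIV. f (Inr j))"
  for f :: "'a::finite + 'b::finite \<Rightarrow> 'c::comm_monoid_add"
  using sum.Plus[of UNIV UNIV f] by simp

lemma block_vec_cases: obtains p q where "x = block_vec p q"
proof
  show "x = block_vec (\<chi> i. x $ Inl i) (\<chi> j. x $ Inr j)"
    unfolding vec_eq_iff by (subst all_sum_iff) simp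
qed

lemma block_mat_cases: obtains W X Y Z where "P = block_mat W X Y Z"
proof
  show "P = block_mat (\<chi> i k. P $ Inl i $ Inl k) (\<chi> i l. P $ Inl i $ Inr l)
      (\<chi> j k. P $ Inr j $ Inl k) (\<chi> j l. P $ Inr j $ Inr l)"
    \<comment> \<open>The first substitution splits the row index; a column quantifier then remains
      in each of the two block rows, whence the occurrences 1 and 2.\<close>
    unfolding vec_eq_iff by (subst all_sum_iff, subst (1 2) all_sum_iff) simp
qed

lemma block_vec_eq_0_iff: "block_vec p q = 0 \<longleftrightarrow> p = 0 \<and> q = 0"
  unfolding vec_eq_iff by (subst all_sum_iff) simp

lemma block_mat_eq_0_iff: "block_mat W X Y Z = 0 \<longleftrightarrow> W = 0 \<and> X = 0 \<and> Y = 0 \<and> Z = 0"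
proof -
  have "block_mat W X Y Z = 0 \<longleftrightarrow> (\<forall>i k. block_mat W X Y Z $ i $ k = 0)"
    by (simp add: vec_eq_iff)
  also have "\<dots> \<longleftrightarrow> (\<forall>i k. W $ i $ k = 0) \<and> (\<forall>i l. X $ i $ l = 0) \<and> (\<forall>j k. Y $ j $ k = 0) \<and> (\<forall>j l. Z $ j $ l = 0)"
    by (subst all_sum_iff, subst (1 2) all_sum_iff) auto
  finally show ?thesis by (simp add: vec_eq_iff)
qed

lemma block_mat_add:
  "block_mat W X Y Z + block_mat W' X' Y' Z' = block_mat (W + W') (X + X') (Y + Y') (Z + Z')"
  unfolding vec_eq_iff by (subst all_sum_iff, subst (1 2) all_sum_iff) simp

lemma block_mat_uminus: "- block_mat W X Y Z = block_mat (- W) (- X) (- Y) (- Z)"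
  unfolding vec_eq_iff by (subst all_sum_iff, subst (1 2) all_sum_iff) simp

lemma transpose_block_mat:
  "transpose (block_mat W X Y Z) = block_mat (transpose W) (transpose Y) (transpose X) (transpose Z)"
  unfolding vec_eq_iff
  by (subst all_sum_iff, subst (1 2) all_sum_iff) (simp add: transpose_def)

lemma block_mat_mul:
  "block_mat W X Y Z ** block_mat W' X' Y' Z' =
   block_mat (W ** W' + X ** Y') (W ** X' + X ** Z') (Y ** W' + Z ** Y') (Y ** X' + Z ** Z')"
  unfolding vec_eq_iff
  by (subst all_sum_iff, subst (1 2) all_sum_iff) (simp add: matrix_matrix_mult_def sum_UNIV_sum)

lemma block_mat_vec: "block_mat W X Y Z *v block_vec p q = block_vec (W *v p + X *v q) (Y *v p + Z *v q)"
  unfolding vec_eq_iff by (subst all_sum_iff) (simp add: matrix_vector_mult_def sum_UNIV_sum)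

lemma block_col_vec: "block_col X Y *v u = block_vec (X *v u) (Y *v u)"
  unfolding vec_eq_iff by (subst all_sum_iff) (simp add: matrix_vector_mult_def)

lemma inner_block_vec: "block_vec p q \<bullet> block_vec p' q' = p \<bullet> p' + q \<bullet> q'"
  by (simp add: inner_vec_def sum_UNIV_sum)

lemma z0_block: "z0 = block_vec 1 0"
  unfolding vec_eq_iff by (subst all_sum_iff) (simp add: z0_def)

lemma trace_block_col:
  "trace (transpose (block_col 0 Y) ** block_mat P11 P12 P21 P22 ** block_col 0 Y)
    = trace (transpose Y ** P22 ** Y)"
  for P11 :: "real^'a^'a" and P22 :: "real^'b^'b"
  by (simp add: trace_congruence block_col_vec block_mat_vec inner_block_vec)

subsection \<open>Diagonal matrices\<close>

lemma diag_mat_vec_nth: "(diag_mat x *v y) $ i = x $ i * y $ i"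
  by (simp add: diag_mat_def matrix_vector_mult_def if_distrib[where f = "\<lambda>a. a * _"] cong: if_cong)

lemma diag_mat_mul: "diag_mat x ** diag_mat y = diag_mat (x * y)"
  by (auto simp: diag_mat_def matrix_matrix_mult_def vec_eq_iff if_distrib[where f = "\<lambda>a. a * _"] cong: if_cong)

lemma diag_mat_one: "diag_mat 1 = mat 1"
  by (simp add: diag_mat_def mat_def vec_eq_iff)

lemma transpose_diag_mat: "transpose (diag_mat x) = diag_mat x"
  by (auto simp: diag_mat_def transpose_def vec_eq_iff)

lemma trace_mul_diag_mat: "trace (X ** diag_mat y) = (\<Sum>i\<in>UNIV. X $ i $ i * y $ i)"
  by (simp add: trace_def diag_mat_def matrix_matrix_mult_def if_distrib[where f = "\<lambda>a. _ * a"] cong: if_cong)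

lemma mul_diag_mat_nth: "(X ** diag_mat y) $ i $ j = X $ i $ j * y $ j"
  by (simp add: matrix_matrix_mult_def diag_mat_def if_distrib[where f = "\<lambda>a. _ * a"] cong: if_cong)

lemma diag_mat_mul_nth: "(diag_mat y ** X) $ i $ j = y $ i * X $ i $ j"
  by (simp add: matrix_matrix_mult_def diag_mat_def if_distrib[where f = "\<lambda>a. a * _"] cong: if_cong)

lemma inner_one: "x \<bullet> 1 = (\<Sum>i\<in>UNIV. x $ i)" for x :: "real^'n"
  by (simp add: inner_vec_def)

lemma inner_diag_mat: "x \<bullet> (diag_mat y *v z) = (\<Sum>i\<in>UNIV. y $ i * x $ i * z $ i)"
  by (simp add: inner_vec_def diag_mat_vec_nth ac_simps)

lemma pos_semidef_diag_mat: "(\<And>i. 0 \<le> x $ i) \<Longrightarrow> pos_semidef (diag_mat x)"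
  by (simp add: pos_semidef_def transpose_diag_mat inner_diag_mat mult.assoc sum_nonneg)

lemma matrix_inv_eqI:
  fixes X Y :: "real^'n^'n"
  assumes "X ** Y = mat 1" "Y ** X = mat 1"
  shows "matrix_inv X = Y"
proof -
  have "X ** matrix_inv X = mat 1 \<and> matrix_inv X ** X = mat 1"
    unfolding matrix_inv_def by (rule someI[of _ Y]) (use assms in simp)
  then show ?thesis
    by (metis assms(2) matrix_mul_assoc matrix_mul_lid matrix_mul_rid)
qed

lemma
  assumes "\<And>i. m $ i \<noteq> 0"
  shows matrix_inv_diag_mat: "matrix_inv (diag_mat m) = diag_mat (\<chi> i. 1 / m $ i)"
    and matrix_inv_diag_mat_right: "diag_mat m ** matrix_inv (diag_mat m) = mat 1"
    and matrix_inv_diag_mat_left: "matrix_inv (diag_mat m) ** diag_mat m = mat 1"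
    and transpose_matrix_inv_diag_mat:
      "transpose (matrix_inv (diag_mat m)) = matrix_inv (diag_mat m)"
proof -
  have one: "m * (\<chi> i. 1 / m $ i) = 1" "(\<chi> i. 1 / m $ i) * m = 1"
    using assms by (simp_all add: vec_eq_iff)
  show eq: "matrix_inv (diag_mat m) = diag_mat (\<chi> i. 1 / m $ i)"
    by (rule matrix_inv_eqI) (simp_all only: diag_mat_mul one diag_mat_one)
  show "diag_mat m ** matrix_inv (diag_mat m) = mat 1" "matrix_inv (diag_mat m) ** diag_mat m = mat 1"
    unfolding eq by (simp_all only: diag_mat_mul one diag_mat_one)
  show "transpose (matrix_inv (diag_mat m)) = matrix_inv (diag_mat m)"
    unfolding eq by (rule transpose_diag_mat)
qed

subsection \<open>Graph Laplacians\<close>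

text \<open>The term with \<open>j = i\<close> vanishes, so the sum may run over all of
  \<open>UNIV\<close> without constraining \<open>w i i\<close>.\<close>

lemma laplacian_vec_nth:
  "(laplacian w *v x) $ i = (\<Sum>j\<in>UNIV. w i j * (x $ i - x $ j))"
proof -
  have "(laplacian w *v x) $ i
      = (\<Sum>k\<in>UNIV - {i}. w i k) * x $ i + (\<Sum>j\<in>UNIV - {i}. - w i j * x $ j)"
    by (simp add: laplacian_def matrix_vector_mult_def sum.remove[of UNIV i])
  also have "\<dots> = (\<Sum>j\<in>UNIV - {i}. w i j * (x $ i - x $ j))"
    by (simp add: sum_distrib_right sum_negf sum_subtractf right_diff_distrib)
  also have "\<dots> = (\<Sum>j\<in>UNIV. w i j * (x $ i - x $ j))"
    by (simp add: sum.remove[of UNIV i])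
  finally show ?thesis .
qed

context
  fixes w :: "'n::finite \<Rightarrow> 'n \<Rightarrow> real"
  assumes w: "nonneg_sym_weights w"
begin

lemma transpose_laplacian: "transpose (laplacian w) = laplacian w"
  using w by (auto simp: nonneg_sym_weights_def laplacian_def transpose_def vec_eq_iff)

lemma laplacian_form:
  "x \<bullet> (laplacian w *v x) = (\<Sum>i\<in>UNIV. \<Sum>j\<in>UNIV. w i j * (x $ i - x $ j)\<^sup>2) / 2"
proof -
  let ?f = "\<lambda>i j. w i j * (x $ i - x $ j) * x $ i"
  have form: "x \<bullet> (laplacian w *v x) = (\<Sum>i\<in>UNIV. \<Sum>j\<in>UNIV. ?f i j)"
    by (simp add: inner_vec_def laplacian_vec_nth sum_distrib_left ac_simps)
  \<comment> \<open>Symmetrisation over ordered pairs. The case split is due to the weights being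
    symmetric only off the diagonal.\<close>
  have "?f i j + ?f j i = w i j * (x $ i - x $ j)\<^sup>2" for i j
  proof (cases "i = j")
    case False
    then have "w j i = w i j" using w by (simp add: nonneg_sym_weights_def)
    then show ?thesis by (simp add: power2_eq_square algebra_simps)
  qed simp
  then have "(\<Sum>i\<in>UNIV. \<Sum>j\<in>UNIV. w i j * (x $ i - x $ j)\<^sup>2)
      = (\<Sum>i\<in>UNIV. \<Sum>j\<in>UNIV. ?f i j) + (\<Sum>i\<in>UNIV. \<Sum>j\<in>UNIV. ?f j i)"
    by (simp add: sum.distrib[symmetric])
  also have "(\<Sum>i\<in>UNIV. \<Sum>j\<in>UNIV. ?f j i) = (\<Sum>i\<in>UNIV. \<Sum>j\<in>UNIV. ?f i j)"
    by (rule sum.swap)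
  finally show ?thesis by (simp add: form)
qed

lemma laplacian_term_nonneg: "0 \<le> w i j * (x $ i - x $ j)\<^sup>2"
  using w by (cases "i = j") (auto simp: nonneg_sym_weights_def)

lemma pos_semidef_laplacian: "pos_semidef (laplacian w)"
  by (simp add: pos_semidef_def transpose_laplacian laplacian_form sum_nonneg laplacian_term_nonneg)

text \<open>A sum of nonnegative terms vanishes only termwise, so \<open>x\<close> agrees across
  every edge, and connectivity carries this along paths.\<close>

lemma laplacian_form_zero:
  assumes "connected_weights w" "x \<bullet> (laplacian w *v x) = 0"
  obtains c where "x = c *\<^sub>R 1"
proof -
  have "w i j * (x $ i - x $ j)\<^sup>2 = 0" for i j
    using assms(2) by (simp add: laplacian_form sum_nonneg_eq_0_iff sum_nonneg laplacian_term_nonneg del: mult_eq_0_iff)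
  then have edge: "x $ i = x $ j" if "0 < w i j" for i j
    using that by (metis less_irrefl mult_eq_0_iff power2_eq_square right_minus_eq)
  have "x $ i = x $ undefined" for i
  proof -
    have "(undefined, i) \<in> {(k, l). k \<noteq> l \<and> 0 < w k l}\<^sup>*"
      using assms(1) by (simp add: connected_weights_def)
    then show ?thesis by induction (use edge in auto)
  qed
  then have "x = x $ undefined *\<^sub>R 1" by (simp add: vec_eq_iff)
  then show ?thesis by (rule that)
qed

end

lemma laplacian_vec_one: "laplacian w *v 1 = 0"
  by (simp add: vec_eq_iff laplacian_vec_nth)

subsection \<open>The swing equations\<close>

locale swing_equation =
  fixes b :: "'n::finite \<Rightarrow> 'n \<Rightarrow> real" and d m :: "real^'n"
  assumes weights: "nonneg_sym_weights b" and connected: "connected_weights b"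
    and d_pos: "\<And>i. 0 < d $ i" and m_pos: "\<And>i. 0 < m $ i"
begin

abbreviation "L \<equiv> laplacian b"
abbreviation "A \<equiv> sys_A L d m"
abbreviation "Mi \<equiv> matrix_inv (diag_mat m)"

lemma m_neq_0: "m $ i \<noteq> 0"
  using m_pos[of i] by simp

lemma sum_d_pos: "0 < (\<Sum>i\<in>UNIV. d $ i)"
  using d_pos by (intro sum_pos) auto

lemma transpose_A: "transpose A = block_mat 0 (- (L ** Mi)) (mat 1) (- (diag_mat d ** Mi))"
  by (simp add: sys_A_def transpose_block_mat transpose_zero transpose_uminus matrix_transpose_mul
      transpose_laplacian[OF weights] transpose_diag_mat transpose_matrix_inv_diag_mat m_neq_0)

lemma A_z0: "A *v z0 = 0"
  by (simp add: sys_A_def z0_block block_mat_vec block_vec_eq_0_iff matrix_vec.minus_left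
      matrix_vector_mul_assoc[symmetric] laplacian_vec_one)

lemma transpose_A_vec:
  "transpose A *v block_vec p q = block_vec (- (L *v (Mi *v q))) (p - diag_mat d *v (Mi *v q))"
  by (simp add: transpose_A block_mat_vec matrix_vec.minus_left matrix_vector_mul_assoc)

lemma Mi_vec_m: "Mi *v m = 1"
  by (simp add: vec_eq_iff diag_mat_vec_nth matrix_inv_diag_mat m_neq_0)

lemma diag_mat_vec_one: "diag_mat x *v 1 = x"
  by (simp add: vec_eq_iff diag_mat_vec_nth)

text \<open>Summing the swing equations cancels all line flows: d.\<theta> + m.\<omega> is constant
  along trajectories.\<close>

lemma transpose_A_conserved: "transpose A *v block_vec d m = 0"
  by (simp add: transpose_A_vec Mi_vec_m laplacian_vec_one diag_mat_vec_one block_vec_eq_0_iff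
      del: transpose_matrix_vector)

lemma conserved_z0: "block_vec d m \<bullet> z0 = (\<Sum>i\<in>UNIV. d $ i)"
  by (simp add: z0_block inner_block_vec inner_one)

lemma transpose_A_kernel:
  assumes "transpose A *v y = 0"
  obtains c where "y = c *\<^sub>R block_vec d m"
proof -
  obtain p q where y: "y = block_vec p q" by (rule block_vec_cases)
  have "L *v (Mi *v q) = 0" and p: "p = diag_mat d *v (Mi *v q)"
    using assms unfolding y transpose_A_vec by (simp_all add: block_vec_eq_0_iff)
  then obtain c where c: "Mi *v q = c *\<^sub>R 1"
    using laplacian_form_zero[OF weights connected, of "Mi *v q"] by auto
  have "q = diag_mat m *v (Mi *v q)"
    by (simp add: matrix_vector_mul_assoc matrix_inv_diag_mat_right m_neq_0)
  then have "q = c *\<^sub>R m"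
    by (simp add: c matrix_vec.scaleR_right diag_mat_vec_one)
  moreover have "p = c *\<^sub>R d"
    by (simp add: p c matrix_vec.scaleR_right diag_mat_vec_one)
  ultimately have "y = c *\<^sub>R block_vec d m"
    unfolding y vec_eq_iff by (subst all_sum_iff) simp
  then show ?thesis by (rule that)
qed

text \<open>Such an \<open>e\<close> is a weight of the cross term small enough for both
  \<open>energy e\<close> and the damping block of \<open>dissipation e\<close> to be positive;
  halving the minimal ratio makes the bound strict.\<close>

lemma damping_bound: obtains e where "0 < e" "\<And>i. e * m $ i < d $ i"
proof -
  define e where "e = Min (range (\<lambda>i. d $ i / m $ i)) / 2"
  have "0 < e"
    using d_pos m_pos by (auto simp: e_def)
  moreover have "e * m $ i < d $ i" for i
  proof -
    have "2 * e \<le> d $ i / m $ i" by (simp add: e_def)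
    then have "2 * e * m $ i \<le> d $ i" using m_pos[of i] by (simp add: field_simps)
    moreover have "0 < e * m $ i" using \<open>0 < e\<close> m_pos[of i] by simp
    ultimately show ?thesis by linarith
  qed
  ultimately show ?thesis by (rule that)
qed

text \<open>The energy \<open>(\<omega> \<bullet> M \<omega> + \<theta> \<bullet> L \<theta>) / 2\<close> only decreases at rate \<open>\<omega> \<bullet> D \<omega>\<close>. Adding \<open>e\<close> times
  \<open>\<theta> \<bullet> D \<theta> / 2 + \<theta> \<bullet> M \<omega>\<close>, whose derivative is exactly \<open>\<omega> \<bullet> M \<omega> - \<theta> \<bullet> L \<theta>\<close>, makes it strict.\<close>

definition energy :: "real \<Rightarrow> real^('n + 'n)^('n + 'n)" where
  "energy e = block_mat ((1/2) *\<^sub>R (L + e *\<^sub>R diag_mat d)) ((e/2) *\<^sub>R diag_mat m)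
     ((e/2) *\<^sub>R diag_mat m) ((1/2) *\<^sub>R diag_mat m)"

definition dissipation :: "real \<Rightarrow> real^('n + 'n)^('n + 'n)" where
  "dissipation e = block_mat (e *\<^sub>R L) 0 0 (diag_mat d - e *\<^sub>R diag_mat m)"

lemma energy_derivative: "energy e ** A + transpose A ** energy e = - dissipation e"
proof -
  have "diag_mat m ** (Mi ** X) = X" "X ** Mi ** diag_mat m = X" for X :: "real^'n^'n"
    by (simp_all add: matrix_mul_assoc matrix_inv_diag_mat_right m_neq_0)
       (simp add: matrix_mul_assoc[symmetric] matrix_inv_diag_mat_left m_neq_0)
  note simps = this
  \<comment> \<open>The summand \<open>e *\<^sub>R diag_mat d\<close> of the energy cancels the
    damping contribution of the cross term, so the off-diagonal blocks of the two products are
    opposite.\<close>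
  have "energy e ** A = block_mat (- ((e/2) *\<^sub>R L)) ((1/2) *\<^sub>R L)
      (- ((1/2) *\<^sub>R L)) ((e/2) *\<^sub>R diag_mat m - (1/2) *\<^sub>R diag_mat d)"
    by (simp add: energy_def sys_A_def block_mat_mul matrix_mul.minus_right matrix_mul.scaleR_left
        simps scaleR_add_right)
  moreover have "transpose A ** energy e = block_mat (- ((e/2) *\<^sub>R L)) (- ((1/2) *\<^sub>R L))
      ((1/2) *\<^sub>R L) ((e/2) *\<^sub>R diag_mat m - (1/2) *\<^sub>R diag_mat d)"
    by (simp add: energy_def transpose_A block_mat_mul matrix_mul.minus_left matrix_mul.scaleR_right
        simps scaleR_add_right)
  moreover have "- ((e/2) *\<^sub>R L) + - ((e/2) *\<^sub>R L) = - (e *\<^sub>R L)"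
      "(e/2) *\<^sub>R diag_mat m - (1/2) *\<^sub>R diag_mat d + ((e/2) *\<^sub>R diag_mat m - (1/2) *\<^sub>R diag_mat d)
        = - (diag_mat d - e *\<^sub>R diag_mat m)"
    by (simp_all add: vec_eq_iff)
  ultimately show ?thesis
    by (simp only: block_mat_add dissipation_def block_mat_uminus) simp
qed

lemma energy_pos:
  assumes e: "0 < e" "\<And>i. e * m $ i < d $ i" and "x \<noteq> 0"
  shows "0 < x \<bullet> (energy e *v x)"
proof -
  obtain p q where x: "x = block_vec p q" by (rule block_vec_cases)
  \<comment> \<open>Completing the square in \<open>q $ i\<close> leaves a coefficient of
    \<open>p $ i\<close> squared that is positive by the choice of \<open>e\<close>.\<close>
  define f where "f i = e * (d $ i - e * m $ i) * (p $ i)\<^sup>2 + m $ i * (q $ i + e * p $ i)\<^sup>2" for i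
  have "x \<bullet> (energy e *v x) = (p \<bullet> (L *v p)) / 2
      + (\<Sum>i\<in>UNIV. e * d $ i * p $ i * p $ i / 2 + e * m $ i * p $ i * q $ i / 2
          + e * m $ i * q $ i * p $ i / 2 + m $ i * q $ i * q $ i / 2)"
    by (simp add: x energy_def block_mat_vec inner_block_vec matrix_vec.add_left inner_add_right
        matrix_vec.scaleR_left inner_diag_mat sum.distrib sum_distrib_left sum_divide_distrib
        algebra_simps)
  also have "(\<lambda>i. e * d $ i * p $ i * p $ i / 2 + e * m $ i * p $ i * q $ i / 2
          + e * m $ i * q $ i * p $ i / 2 + m $ i * q $ i * q $ i / 2) = (\<lambda>i. f i / 2)"
    by (simp add: fun_eq_iff f_def power2_eq_square field_simps)
  finally have form: "x \<bullet> (energy e *v x) = (p \<bullet> (L *v p)) / 2 + (\<Sum>i\<in>UNIV. f i / 2)" .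
  have nonneg: "0 \<le> f i" for i
    using e(1) e(2)[of i] m_pos[of i] by (simp add: f_def)
  have "\<exists>i. 0 < f i"
  proof (rule ccontr)
    assume "\<nexists>i. 0 < f i"
    then have f0: "f i = 0" for i
      using nonneg[of i] by (metis order_le_less)
    have "p $ i = 0 \<and> q $ i = 0" for i
    proof -
      have "0 \<le> e * (d $ i - e * m $ i) * (p $ i)\<^sup>2" "0 \<le> m $ i * (q $ i + e * p $ i)\<^sup>2"
        using e(1) e(2)[of i] m_pos[of i] by simp_all
      then have "e * (d $ i - e * m $ i) * (p $ i)\<^sup>2 = 0" "m $ i * (q $ i + e * p $ i)\<^sup>2 = 0"
        using f0[of i] unfolding f_def by linarith+
      then show ?thesis using e(1) e(2)[of i] m_pos[of i] by auto
    qed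
    then have "p = 0" "q = 0" by (simp_all add: vec_eq_iff)
    then show False
      using \<open>x \<noteq> 0\<close> by (simp add: x block_vec_eq_0_iff)
  qed
  then have "0 < (\<Sum>i\<in>UNIV. f i / 2)"
    using nonneg by (auto intro: sum_pos2)
  moreover have "0 \<le> p \<bullet> (L *v p)"
    using pos_semidef_laplacian[OF weights] by (simp add: pos_semidef_def)
  ultimately show ?thesis by (simp add: form)
qed

text \<open>The form vanishes only where \<omega> = 0 and \<theta> is constant, that is, on
  multiples of \<open>z0\<close>; since the entries of \<open>d\<close> have positive sum, the
  hyperplane contains only the zero multiple.\<close>

lemma dissipation_pos:
  assumes e: "0 < e" "\<And>i. e * m $ i < d $ i" and x: "block_vec d m \<bullet> x = 0" "x \<noteq> 0"
  shows "0 < x \<bullet> (dissipation e *v x)"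
proof (rule ccontr)
  obtain p q where pq: "x = block_vec p q" by (rule block_vec_cases)
  have form: "x \<bullet> (dissipation e *v x) = e * (p \<bullet> (L *v p)) + (\<Sum>i\<in>UNIV. (d $ i - e * m $ i) * (q $ i)\<^sup>2)"
    by (simp add: pq dissipation_def block_mat_vec inner_block_vec matrix_vec.diff_left inner_diff_right
        matrix_vec.scaleR_left inner_diag_mat sum_subtractf[symmetric] sum_distrib_left power2_eq_square
        algebra_simps)
  have nonneg: "0 \<le> (d $ i - e * m $ i) * (q $ i)\<^sup>2" for i
    using e(2)[of i] by simp
  then have sum_nonneg: "0 \<le> (\<Sum>i\<in>UNIV. (d $ i - e * m $ i) * (q $ i)\<^sup>2)"
    by (intro sum_nonneg) auto
  have L_nonneg: "0 \<le> e * (p \<bullet> (L *v p))"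
    using pos_semidef_laplacian[OF weights] e(1) by (simp add: pos_semidef_def)
  assume "\<not> 0 < x \<bullet> (dissipation e *v x)"
  then have "e * (p \<bullet> (L *v p)) = 0" and "(\<Sum>i\<in>UNIV. (d $ i - e * m $ i) * (q $ i)\<^sup>2) = 0"
    using sum_nonneg L_nonneg by (simp_all only: form)
  then have "p \<bullet> (L *v p) = 0" and "\<And>i. (d $ i - e * m $ i) * (q $ i)\<^sup>2 = 0"
    using e(1) nonneg by (simp_all add: sum_nonneg_eq_0_iff del: mult_eq_0_iff)
  then obtain c where c: "p = c *\<^sub>R 1" and q: "q = 0"
    using laplacian_form_zero[OF weights connected] e(2)
    by (metis (no_types, opaque_lifting) less_irrefl mult_eq_0_iff power2_eq_square right_minus_eq
        vec_eq_iff zero_index)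
  have "c * (\<Sum>i\<in>UNIV. d $ i) = 0"
    using x(1) by (simp add: pq c q inner_block_vec inner_one)
  then have "c = 0" using sum_d_pos by simp
  then show False using x(2) by (simp add: pq c q block_vec_eq_0_iff)
qed

lemma mat_exp_A_tendsto:
  "\<exists>\<alpha>. ((\<lambda>t. mat_exp (t *\<^sub>R A) *v x) \<longlongrightarrow> \<alpha> *\<^sub>R z0) at_top"
proof -
  let ?l = "block_vec d m"
  \<comment> \<open>The conserved functional determines the limit: this coefficient makes it vanish
    on \<open>y 0\<close>, and hence on all of \<open>y\<close>.\<close>
  define \<alpha> where "\<alpha> = (?l \<bullet> x) / (\<Sum>i\<in>UNIV. d $ i)"
  define y where "y t = mat_exp (t *\<^sub>R A) *v x - \<alpha> *\<^sub>R z0" for t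
  have y': "(y has_vector_derivative A *v y t) (at t)" for t
  proof -
    have "(y has_vector_derivative A *v (mat_exp (t *\<^sub>R A) *v x) - 0) (at t)"
      unfolding y_def by (intro derivative_intros has_vector_derivative_mat_exp_mult)
    then show ?thesis by (simp add: y_def matrix_vec.diff_right matrix_vec.scaleR_right A_z0)
  qed
  have "((\<lambda>t. ?l \<bullet> y t) has_real_derivative 0) (at t)" for t
  proof -
    have "((\<lambda>t. ?l \<bullet> y t) has_vector_derivative ?l \<bullet> (A *v y t)) (at t)"
      by (rule bounded_linear.has_vector_derivative[OF bounded_linear_inner_right y'])
    moreover have "?l \<bullet> (A *v y t) = (transpose A *v ?l) \<bullet> y t"
      by (metis inner_commute inner_transpose)
    ultimately show ?thesis
      by (simp add: has_real_derivative_iff_has_vector_derivative transpose_A_conserved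
          del: transpose_matrix_vector)
  qed
  then have "?l \<bullet> y t = ?l \<bullet> y 0" for t
    using DERIV_isconst_all by blast
  moreover have "?l \<bullet> y 0 = 0"
    using sum_d_pos by (simp add: y_def mat_exp_zero inner_diff_right conserved_z0 \<alpha>_def)
  ultimately have "y t \<in> {x. ?l \<bullet> x = 0}" for t by simp
  moreover obtain e where "0 < e" "\<And>i. e * m $ i < d $ i" using damping_bound by blast
  ultimately have "(y \<longlongrightarrow> 0) at_top"
    by (intro strict_lyapunov_tendsto_zero[OF y' _ subspace_hyperplane energy_pos dissipation_pos energy_derivative])
       auto
  then have "((\<lambda>t. y t + \<alpha> *\<^sub>R z0) \<longlongrightarrow> 0 + \<alpha> *\<^sub>R z0) at_top"
    by (intro tendsto_intros)
  then show ?thesis by (auto simp: y_def)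
qed

text \<open>\<open>P\<close> is not assumed symmetric, so the vanishing of \<open>z0\<^sup>T P\<close> needs an argument: this row vector
  is a left null vector of \<open>A\<close>, hence a multiple of the conserved functional, and it vanishes at \<open>z0\<close>.\<close>

lemma lyapunov_left_null:
  assumes "P ** A + transpose A ** P + Q = 0" "P *v z0 = 0" "transpose Q = Q" "Q *v z0 = 0"
  shows "transpose P *v z0 = 0"
proof -
  have "transpose (P ** A + transpose A ** P + Q) *v z0 = 0"
    by (simp only: assms(1) transpose_zero matrix_vec.zero_left)
  then have "transpose A *v (transpose P *v z0) = 0"
    using assms(3,4)
    by (simp add: transpose_add matrix_transpose_mul matrix_vec.add_left A_z0
        matrix_vector_mul_assoc[symmetric] del: transpose_matrix_vector)
  then obtain c where c: "transpose P *v z0 = c *\<^sub>R block_vec d m"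
    by (rule transpose_A_kernel)
  have "z0 \<bullet> (transpose P *v z0) = 0"
    by (simp add: inner_transpose assms(2) del: transpose_matrix_vector)
  then have "c * (\<Sum>i\<in>UNIV. d $ i) = 0"
    by (simp add: c inner_commute[of z0] conserved_z0 del: transpose_matrix_vector)
  then show ?thesis using sum_d_pos c by simp
qed

end

subsection \<open>The reduced objective\<close>

definition ones :: "real^'n^'n" where "ones = (\<chi> i j. 1)"

lemma ones_vec: "ones *v x = (\<Sum>i\<in>UNIV. x $ i) *\<^sub>R 1"
  by (simp add: vec_eq_iff ones_def matrix_vector_mult_def)

lemma transpose_ones: "transpose ones = ones"
  by (simp add: ones_def transpose_def)

lemma mul_ones_zero: "X *v 1 = 0 \<Longrightarrow> X ** ones = (0 :: real^'n^'n)" for X :: "real^'n^'n"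
  by (simp add: vec_eq_iff matrix_matrix_mult_def matrix_vector_mult_def ones_def)

text \<open>\<open>G\<close> is the inverse of \<open>laplacian w + ones\<close>. The form of that
  sum adds the square of the sum of the entries, which excludes the constant vectors from the
  kernel. \<open>G\<close> sends \<open>ones\<close> to a multiple of itself, so removing
  \<open>ones\<close> leaves the projection off the constants.\<close>

lemma laplacian_regularized_inverse:
  fixes w :: "'n::finite \<Rightarrow> 'n \<Rightarrow> real"
  assumes w: "nonneg_sym_weights w" "connected_weights w"
  obtains G where "G ** laplacian w = mat 1 - (1 / real CARD('n)) *\<^sub>R ones"
    "laplacian w ** G = mat 1 - (1 / real CARD('n)) *\<^sub>R ones"
proof -
  let ?L = "laplacian w" and ?n = "real CARD('n)"
  have "x = 0" if x: "(?L + ones) *v x = 0" for x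
  proof -
    let ?s = "\<Sum>i\<in>UNIV. x $ i"
    have "x \<bullet> (?L *v x) + ?s * ?s = x \<bullet> ((?L + ones) *v x)"
      by (simp add: matrix_vec.add_left inner_add_right ones_vec inner_one)
    then have eq: "x \<bullet> (?L *v x) + ?s * ?s = 0" using x by simp
    have "0 \<le> x \<bullet> (?L *v x)"
      using pos_semidef_laplacian[OF w(1)] by (simp add: pos_semidef_def)
    moreover have "0 \<le> ?s * ?s" by simp
    ultimately have "x \<bullet> (?L *v x) = 0" "?s * ?s = 0" using eq by linarith+
    then obtain c where c: "x = c *\<^sub>R 1" and "?s = 0"
      using laplacian_form_zero[OF w] by (metis mult_eq_0_iff)
    then have "c = 0" by simp
    with c show ?thesis by simp
  qed
  then have "\<exists>G. G ** (?L + ones) = mat 1"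
    unfolding matrix_left_invertible_ker by blast
  then obtain G where G: "G ** (?L + ones) = mat 1" "(?L + ones) ** G = mat 1"
    by (meson matrix_left_right_inverse)
  have L1: "?L ** ones = 0" by (rule mul_ones_zero[OF laplacian_vec_one])
  have "ones ** ?L = transpose (?L ** ones)"
    by (simp add: matrix_transpose_mul transpose_ones transpose_laplacian[OF w(1)])
  then have L1': "ones ** ?L = 0" by (simp add: L1 transpose_zero)
  have sq: "ones ** ones = ?n *\<^sub>R (ones :: real^'n^'n)"
    by (simp add: vec_eq_iff matrix_matrix_mult_def ones_def)
  have "ones = G ** ((?L + ones) ** ones)"
    by (simp add: matrix_mul_assoc G)
  also have "\<dots> = ?n *\<^sub>R (G ** ones)"
    by (simp add: matrix_mul.add_left L1 sq matrix_mul.scaleR_right)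
  finally have G1: "G ** ones = (1 / ?n) *\<^sub>R ones"
    by (metis (no_types, lifting) divide_self_if of_nat_eq_0_iff scaleR_one scaleR_scaleR
        times_divide_eq_left mult_1 zero_less_card_finite less_irrefl)
  have "ones = (ones ** (?L + ones)) ** G"
    by (simp add: matrix_mul_assoc[symmetric] G)
  also have "\<dots> = ?n *\<^sub>R (ones ** G)"
    by (simp add: matrix_mul.add_right L1' sq matrix_mul.scaleR_left)
  finally have G1': "ones ** G = (1 / ?n) *\<^sub>R ones"
    by (metis (no_types, lifting) divide_self_if of_nat_eq_0_iff scaleR_one scaleR_scaleR
        times_divide_eq_left mult_1 zero_less_card_finite less_irrefl)
  show ?thesis
  proof (rule that)
    show "G ** ?L = mat 1 - (1 / ?n) *\<^sub>R ones"
      using G(1) by (simp add: matrix_mul.add_right G1 eq_diff_eq)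
    show "?L ** G = mat 1 - (1 / ?n) *\<^sub>R ones"
      using G(2) by (simp add: matrix_mul.add_left G1' eq_diff_eq)
  qed
qed

lemma (in swing_equation) trace_eq:
  assumes G: "G ** L = mat 1 - (1 / real CARD('n)) *\<^sub>R ones"
      "L ** G = mat 1 - (1 / real CARD('n)) *\<^sub>R ones"
    and N: "N *v 1 = 0" "transpose N = N"
    and v: "\<And>i. 0 \<le> v $ i" "\<And>i. v $ i = ratio * d $ i"
    and P: "P ** A + transpose A ** P + block_mat N 0 0 (diag_mat s) = 0" "P *v z0 = 0"
  shows "trace (transpose (sys_B v m) ** P ** sys_B v m)
    = ratio / 2 * (reduced_objective s m + trace (G ** N))"
proof -
  obtain P11 P12 P21 P22 where Pb: "P = block_mat P11 P12 P21 P22" by (rule block_mat_cases)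
  let ?D = "diag_mat d" and ?S = "diag_mat s" and ?J = "(1 / real CARD('n)) *\<^sub>R ones :: real^'n^'n"
  have "transpose P *v z0 = 0"
    using P N by (intro lyapunov_left_null[OF P])
      (simp_all add: transpose_block_mat transpose_zero transpose_diag_mat z0_block block_mat_vec
        block_vec_eq_0_iff)
  \<comment> \<open>The blocks \<open>P12\<close> and \<open>P21\<close> annihilate constants on the
    left and right respectively; this removes the averaging matrix \<open>?J\<close> from the traces
    below.\<close>
  then have "transpose P12 *v 1 = 0"
    by (simp add: Pb transpose_block_mat z0_block block_mat_vec block_vec_eq_0_iff del: transpose_matrix_vector)
  then have "transpose (transpose P12 ** ones) = 0"
    by (simp only: mul_ones_zero transpose_zero)
  then have left: "ones ** P12 = 0" by (simp add: matrix_transpose_mul transpose_ones)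
  have right: "P21 ** ones = 0"
    using P(2) by (intro mul_ones_zero) (simp add: Pb z0_block block_mat_vec block_vec_eq_0_iff)
  \<comment> \<open>These are the \<theta>\<theta>-block and the \<omega>\<omega>-block of the
    Lyapunov equation.\<close>
  have blocks: "N = P12 ** Mi ** L + L ** Mi ** P21"
      "P21 + P12 + ?S = P22 ** Mi ** ?D + ?D ** Mi ** P22"
    using P(1) unfolding Pb transpose_A
    by (simp_all add: sys_A_def block_mat_mul block_mat_add block_mat_eq_0_iff matrix_mul.minus_left
        matrix_mul.minus_right matrix_mul_assoc algebra_simps eq_neg_iff_add_eq_0)
  have "trace (G ** N) = trace (G ** (P12 ** Mi ** L)) + trace (G ** (L ** Mi ** P21))"
    by (simp add: blocks(1) matrix_mul.add_right trace_add)
  \<comment> \<open>Cyclicity of the trace brings \<open>L\<close> next to \<open>G\<close>, where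
    their product is the identity minus \<open>?J\<close>.\<close>
  also have "trace (G ** (P12 ** Mi ** L)) = trace (P12 ** Mi ** (L ** G))"
    by (subst trace_mul_sym) (simp add: matrix_mul_assoc)
  also have "\<dots> = trace (P12 ** Mi)"
  proof -
    have "trace (P12 ** Mi ** ?J) = trace (?J ** P12 ** Mi)"
      by (subst trace_mul_sym) (simp add: matrix_mul_assoc)
    also have "\<dots> = 0" by (simp add: matrix_mul.scaleR_left left trace_0[simplified])
    finally show ?thesis by (simp add: G matrix_mul.diff_right trace_sub)
  qed
  also have "trace (G ** (L ** Mi ** P21)) = trace (G ** L ** (Mi ** P21))"
    by (simp add: matrix_mul_assoc)
  also have "\<dots> = trace (Mi ** P21)"
  proof -
    have "trace (?J ** (Mi ** P21)) = trace (Mi ** (P21 ** ?J))"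
      by (subst trace_mul_sym) (simp add: matrix_mul_assoc)
    also have "\<dots> = 0" by (simp add: matrix_mul.scaleR_right right trace_0[simplified])
    finally show ?thesis by (simp add: G matrix_mul.diff_left trace_sub)
  qed
  also have "trace (Mi ** P21) = trace (P21 ** Mi)"
    by (rule trace_mul_sym)
  also have "trace (P12 ** Mi) + trace (P21 ** Mi) = (\<Sum>i\<in>UNIV. (P12 $ i $ i + P21 $ i $ i) / m $ i)"
    by (simp add: matrix_inv_diag_mat m_neq_0 trace_mul_diag_mat sum.distrib
        add_divide_distrib)
  finally have tr: "trace (G ** N) = (\<Sum>i\<in>UNIV. (P12 $ i $ i + P21 $ i $ i) / m $ i)" .
  have diag: "2 * (P22 $ i $ i * d $ i / m $ i) = P21 $ i $ i + P12 $ i $ i + s $ i" for i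
  proof -
    have "(P21 + P12 + ?S) $ i $ i = (P22 ** Mi ** ?D + ?D ** Mi ** P22) $ i $ i"
      by (simp only: blocks(2))
    then show ?thesis
      by (simp add: matrix_inv_diag_mat m_neq_0 mul_diag_mat_nth diag_mat_mul diag_mat_mul_nth)
         (simp add: diag_mat_def)
  qed
  let ?R = "mat_sqrt (diag_mat v)"
  have R: "transpose ?R = ?R" "?R ** ?R = diag_mat v"
    using mat_sqrt(2,3)[OF pos_semidef_diag_mat] v(1) by blast+
  have "trace (transpose (sys_B v m) ** P ** sys_B v m) = trace (transpose (Mi ** ?R) ** P22 ** (Mi ** ?R))"
    unfolding sys_B_def Pb by (rule trace_block_col)
  also have "\<dots> = trace (?R ** (Mi ** P22 ** Mi ** ?R))"
    by (simp add: matrix_transpose_mul R transpose_matrix_inv_diag_mat m_neq_0 matrix_mul_assoc)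
  also have "\<dots> = trace ((Mi ** P22 ** Mi ** ?R) ** ?R)"
    by (rule trace_mul_sym)
  also have "\<dots> = trace (Mi ** P22 ** Mi ** diag_mat v)"
    by (simp add: matrix_mul_assoc[symmetric] R)
  also have "\<dots> = (\<Sum>i\<in>UNIV. P22 $ i $ i * v $ i / (m $ i * m $ i))"
    by (simp add: matrix_inv_diag_mat m_neq_0 trace_mul_diag_mat mul_diag_mat_nth diag_mat_mul_nth)
  also have "\<dots> = (\<Sum>i\<in>UNIV. ratio / 2 * (s $ i / m $ i + (P12 $ i $ i + P21 $ i $ i) / m $ i))"
  \<comment> \<open>The uniform ratio turns \<open>v $ i\<close> into a multiple of
    \<open>d $ i\<close>, producing exactly the combination that \<open>diag\<close>
    evaluates.\<close>
  proof (rule sum.cong[OF refl])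
    fix i
    have "P22 $ i $ i * v $ i / (m $ i * m $ i)
        = ratio / 2 * ((2 * (P22 $ i $ i * d $ i / m $ i)) / m $ i)"
      by (simp add: v(2))
    then show "P22 $ i $ i * v $ i / (m $ i * m $ i)
        = ratio / 2 * (s $ i / m $ i + (P12 $ i $ i + P21 $ i $ i) / m $ i)"
      unfolding diag by (simp add: add_divide_distrib)
  qed
  finally show ?thesis
    by (simp add: tr reduced_objective_def sum_distrib_left sum.distrib distrib_left)
qed

section \<open>Convexity of the reduced problem\<close>

lemma convex_inertia_set: "convex (inertia_set mlo mhi mbdg :: (real^'n) set)"
proof (rule convexI)
  fix x y :: "real^'n" and u w :: real
  assume xy: "x \<in> inertia_set mlo mhi mbdg" "y \<in> inertia_set mlo mhi mbdg"
    and uw: "0 \<le> u" "0 \<le> w" "u + w = 1"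
  have "u * (\<Sum>i\<in>UNIV. x $ i) + w * (\<Sum>i\<in>UNIV. y $ i) \<le> mbdg"
    using xy uw by (intro convex_bound_le) (auto simp: inertia_set_def)
  then have "(\<Sum>i\<in>UNIV. (u *\<^sub>R x + w *\<^sub>R y) $ i) \<le> mbdg"
    by (simp add: sum.distrib sum_distrib_left)
  moreover have "(u *\<^sub>R x + w *\<^sub>R y) $ i \<in> {mlo $ i..mhi $ i}" for i
  proof -
    have "x $ i \<in> {mlo $ i..mhi $ i}" "y $ i \<in> {mlo $ i..mhi $ i}"
      using xy by (auto simp: inertia_set_def)
    from convexD[OF convex_closed_interval[of "mlo $ i" "mhi $ i", unfolded interval_cbox[symmetric]] this uw]
    show ?thesis by simp
  qed
  ultimately show "u *\<^sub>R x + w *\<^sub>R y \<in> inertia_set mlo mhi mbdg"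
    unfolding inertia_set_def by blast
qed

text \<open>A combination, with nonnegative coefficients, of reciprocals of coordinates, each convex
  on the positive reals.\<close>

lemma convex_on_reduced_objective:
  fixes s :: "real^'n"
  assumes "\<And>i. 0 \<le> s $ i" "convex S" "\<And>m i. m \<in> S \<Longrightarrow> 0 < m $ i"
  shows "convex_on S (reduced_objective s)"
proof (rule convex_onI[OF _ assms(2)])
  fix t x y
  assume t: "0 < t" "t < (1::real)" and xy: "x \<in> S" "y \<in> S"
  have "inverse ((1 - t) * x $ i + t * y $ i) \<le> (1 - t) * inverse (x $ i) + t * inverse (y $ i)" for i
    using convex_onD[OF convex_on_inverse[of "{0<..}"], of t "x $ i" "y $ i"] t xy assms(3) by auto
  then have "s $ i * inverse ((1 - t) * x $ i + t * y $ i)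
      \<le> s $ i * ((1 - t) * inverse (x $ i) + t * inverse (y $ i))" for i
    using assms(1) by (intro mult_left_mono) auto
  then have "(\<Sum>i\<in>UNIV. s $ i * inverse ((1 - t) * x $ i + t * y $ i))
      \<le> (\<Sum>i\<in>UNIV. s $ i * ((1 - t) * inverse (x $ i) + t * inverse (y $ i)))"
    by (intro sum_mono)
  also have "\<dots> = (1 - t) * reduced_objective s x + t * reduced_objective s y"
    by (simp add: reduced_objective_def sum_distrib_left sum.distrib[symmetric] divide_inverse algebra_simps)
  finally show "reduced_objective s ((1 - t) *\<^sub>R x + t *\<^sub>R y)
      \<le> (1 - t) * reduced_objective s x + t * reduced_objective s y"
    by (simp add: reduced_objective_def divide_inverse)
qed

section \<open>Equivalence of the two optimisation problems\<close>

theorem theorem4: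
  fixes b a :: "'n::finite \<Rightarrow> 'n \<Rightarrow> real"
    and d v s mlo mhi :: "real^'n"
    and mbdg ratio :: real
    and L N :: "real^'n^'n"
  assumes "nonneg_sym_weights b" and "connected_weights b" and "L = laplacian b"
    and "nonneg_sym_weights a" and "connected_weights a" and "N = laplacian a"
    and "\<And>i. 0 < d $ i" and "\<And>i. 0 \<le> v $ i" and "\<And>i. 0 < s $ i"
    and "\<And>i. 0 < mlo $ i" and "\<And>i. mlo $ i \<le> mhi $ i"
    and "0 < ratio" and "\<And>i. v $ i / d $ i = ratio"
  shows "(\<forall>m P. alloc_feasible L N d s mlo mhi mbdg (m, P) \<longrightarrow>
            h2_integrand (sys_A L d m) (sys_B v m) (sys_C N s) integrable_on {0..} \<and>
            h2_norm_sq (sys_A L d m) (sys_B v m) (sys_C N s) = alloc_objective v (m, P)) \<and>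
         convex (inertia_set mlo mhi mbdg) \<and>
         convex_on (inertia_set mlo mhi mbdg) (reduced_objective s) \<and>
         (\<forall>m. (\<exists>P. is_arg_min (alloc_objective v) (alloc_feasible L N d s mlo mhi mbdg) (m, P)) \<longleftrightarrow>
              is_arg_min (reduced_objective s) (\<lambda>x. x \<in> inertia_set mlo mhi mbdg) m)"
proof -
  define Q where "Q = block_mat N 0 0 (diag_mat s)"
  have CC: "transpose (sys_C N s) ** sys_C N s = Q"
  proof -
    have "pos_semidef N" "pos_semidef (diag_mat s)"
      using assms(4,6,9) by (auto simp: pos_semidef_laplacian less_imp_le intro!: pos_semidef_diag_mat)
    then show ?thesis
      by (simp add: sys_C_def transpose_block_mat transpose_zero block_mat_mul mat_sqrt Q_def)
  qed
  have N: "N *v 1 = 0" "transpose N = N"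
    by (simp_all add: assms(4,6) laplacian_vec_one transpose_laplacian)
  have Q: "transpose Q = Q" "Q *v z0 = 0"
    by (simp_all add: Q_def transpose_block_mat transpose_zero transpose_diag_mat N z0_block
        block_mat_vec block_vec_eq_0_iff)
  have v: "v $ i = ratio * d $ i" for i
    using assms(13)[of i] assms(7)[of i] by (simp add: field_simps)
  have m_pos: "0 < m $ i" if "m \<in> inertia_set mlo mhi mbdg" for m i
    using that assms(10)[of i] by (auto simp: inertia_set_def intro: less_le_trans)
  have swing: "swing_equation b d m" if "m \<in> inertia_set mlo mhi mbdg" for m
    using assms m_pos[OF that] by unfold_locales
  \<comment> \<open>\<open>G\<close> depends on the network alone and is fixed before any
    \<open>m\<close>, so \<open>trace (G ** N)\<close> is one constant for the whole
    problem.\<close>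
  obtain G where G: "G ** laplacian b = mat 1 - (1 / real CARD('n)) *\<^sub>R ones"
      "laplacian b ** G = mat 1 - (1 / real CARD('n)) *\<^sub>R ones"
    using laplacian_regularized_inverse[OF assms(1,2)] by blast
  have feasible: "alloc_feasible L N d s mlo mhi mbdg (m, P) \<longleftrightarrow> m \<in> inertia_set mlo mhi mbdg \<and>
      P ** sys_A L d m + transpose (sys_A L d m) ** P + Q = 0 \<and> P *v z0 = 0" for m P
    by (simp add: alloc_feasible_def CC)
  \<comment> \<open>Every admissible \<open>m\<close> extends to a feasible pair, so eliminating
    \<open>P\<close> loses no candidates.\<close>
  have ex: "\<exists>P. alloc_feasible L N d s mlo mhi mbdg (m, P)" if m: "m \<in> inertia_set mlo mhi mbdg" for m
  proof -
    interpret swing_equation b d m by (rule swing[OF m])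
    show ?thesis
      unfolding feasible unfolding assms(3)
      using lyapunov_equation_solvable[OF mat_exp_A_tendsto A_z0 Q] m by blast
  qed
  have objective: "alloc_objective v (m, P) = ratio / 2 * (reduced_objective s m + trace (G ** N))"
    if "alloc_feasible L N d s mlo mhi mbdg (m, P)" for m P
  proof -
    have m: "m \<in> inertia_set mlo mhi mbdg" using that by (simp add: feasible)
    interpret swing_equation b d m by (rule swing[OF m])
    show ?thesis
      using that[unfolded feasible] trace_eq[OF G N assms(8) v, of P s]
      by (simp add: Q_def assms(3) alloc_objective_def)
  qed
  have h2: "(h2_integrand (sys_A L d m) (sys_B v m) (sys_C N s) has_integral alloc_objective v (m, P)) {0..}"
    if "alloc_feasible L N d s mlo mhi mbdg (m, P)" for m P
  proof -
    have m: "m \<in> inertia_set mlo mhi mbdg" using that by (simp add: feasible)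
    interpret swing_equation b d m by (rule swing[OF m])
    show ?thesis
      using that[unfolded feasible] h2_integrand_has_integral[OF mat_exp_A_tendsto, of P "sys_C N s" "sys_B v m"]
      by (simp add: CC assms(3) alloc_objective_def)
  qed
  \<comment> \<open>On feasible pairs the objective is a positive multiple of the reduced objective
    plus a constant, hence induces the same strict order.\<close>
  have less: "alloc_objective v (x, X) < alloc_objective v (m, P) \<longleftrightarrow> reduced_objective s x < reduced_objective s m"
    if "alloc_feasible L N d s mlo mhi mbdg (x, X)" "alloc_feasible L N d s mlo mhi mbdg (m, P)" for x X m P
    using assms(12) by (simp add: objective[OF that(1)] objective[OF that(2)])
  have "(\<exists>P. is_arg_min (alloc_objective v) (alloc_feasible L N d s mlo mhi mbdg) (m, P)) \<longleftrightarrow>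
      is_arg_min (reduced_objective s) (\<lambda>x. x \<in> inertia_set mlo mhi mbdg) m" (is "?l \<longleftrightarrow> ?r") for m
  proof
    assume ?l
    then show ?r
      unfolding is_arg_min_def using ex less feasible by metis
  next
    assume ?r
    then show ?l
      unfolding is_arg_min_def split_paired_all using ex less feasible by (metis surj_pair)
  qed
  moreover have "convex_on (inertia_set mlo mhi mbdg) (reduced_objective s)"
    using assms(9) m_pos by (intro convex_on_reduced_objective convex_inertia_set) (auto simp: less_imp_le)
  ultimately show ?thesis
    using convex_inertia_set
    by (simp add: h2_norm_sq_def has_integral_integrable[OF h2] integral_unique[OF h2])
qed

end
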